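(* For every $R\ge 1$ (and every sample size $n\ge 1$), the estimator $$\hat{k}_{R,n}=\arg\min_{f\in K_R}\int_0^\infty |g_n(\lambda)-\mathbf{T}f(\lambda)|^2w(\lambda)\,d\lambda$$ is well defined, i.e. the minimizer $\hat{k}_{R,n}$ exists, is unique, and is measurable (as a random element of $\mathcal{L}(\mu)$, a function of the observations).
   Context: Model. Let $\beta,b,c>0$ be known constants and let $n(dz)=k(z)\,dz$ be a Lévy intensity on $(0,\infty)$ with $k\ge 0$ and $\int_0^\infty (1\wedge z)k(z)\,dz<\infty$. Let $\{X(t)\}$ be the nonnegative solution of $$dX(t)=b(\beta-X(t))\,dt+\sqrt{2cX(t)}\,dB(t)+\int_0^\infty z\,N(dt,dz),$$ where $B$ is a standard Brownian motion and $N$ is a Poisson random measure on $(0,\infty)^2$ with Lévy intensity $n(dz)$. $X$ is Markov with transition semigroup $(P_t)_{t\ge0}$ given by $$\int_0^\infty e^{-\lambda y}P_t(x,dy)=\exp\Big\{-xv_t(\lambda)-\int_0^t\psi(v_s(\lambda))\,ds\Big\},\quad v_t(\lambda)=\frac{be^{-bt}\lambda}{b+c\lambda(1-e^{-bt})},\quad \psi(z)=b\beta z+\int_0^\infty(1-e^{-zu})\,n(du).$$ It is assumed throughout that $X$ is stationary (with marginal law the unique invariant distribution $\eta$, whose Laplace transform is $\exp\{-\int_0^\infty\psi(v_s(\lambda))ds\}$) and ergodic. The observations are $X_k=X(k)$, $k=0,1,2,\dots$. Function spaces. All functions are defined on $\mathbb{R}_+=[0,\infty)$. Let $\mu(dz)=(1\wedge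 z)\,dz$, $\mu(|f|)=\int_0^\infty|f(z)|\,\mu(dz)$ and $\mathcal{L}(\mu)=\{f:\mu(|f|)<\infty\}$, with norm $f\mapsto\mu(|f|)$. For an interval $[a,b']\subset\mathbb{R}_+$ let $V_a^{b'}(f)$ be the total variation of $f$ on $[a,b']$, i.e. the supremum of $\sum_{i=0}^{m-1}|f(x_{i+1})-f(x_i)|$ over all partitions $a=x_0<\cdots<x_m=b'$; $\mathscr{V}_b$ is the set of real-valued $f$ with $V_a^{b'}(f)<\infty$ for all such intervals. Let $$K=\{f\in\mathcal{L}(\mu)\cap\mathscr{V}_b: f\text{ is nonnegative and right-continuous}\}.$$ Let $\{k_R\ge 0:R=1,2,\dots\}$ be a fixed increasing sequence of functions with $\mu(|k_R|)\le R$, and $$K_R=\{f\in K: f\le k_R\text{ and }V_i^{i+1}(f)\vee V_{(i+1)^{-1}}^{i^{-1}}(f)\le R\text{ for all }i=1,2,\dots\}.$$ Operator and statistics. $\mathbf{T}f(\lambda)=\int_0^1\int_0^\infty(1-e^{-zv_s(\lambda)})f(z)\,dz\,ds$ for $f\in\mathcal{L}(\mu)$. With $v(\lambda)=v_1(\lambda)$ and $D=\frac{b\beta}{c}\log(1+c\lambda(1-e^{-b})/b)$, $$L_n(\lambda)=\frac1n\sum_{k=1}^n e^{-\lambda X_k+X_{k-1}v(\lambda)+D},\qquad g_n(\lambda)=-\ln L_n(\lambda).$$ $w$ is a bounded nonnegative weight function on $\mathbb{R}_+$ with compact support $S_w$, such that $[a_0,b_0]\subset S_w$ for some $0\le a_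0<b_0<\infty$.
   Formalization: Functions live on (0,∞), with bounded variation only on compact intervals there; in K_R the bounds f ≤ k_R and on the variations are required of some μ-a.e. version of f, since the literal K_R is not closed and a minimizer may fail to exist; S_w is the essential support of w. *)

theory Defs
  imports "HOL-Probability.Probability"
begin

section \<open>The function spaces\<close>

text \<open>
  A function on the positive half line is encoded as an extensional function on \<open>{0<..}\<close>, so that
  equality of two such functions is equality on \<open>{0<..}\<close>. The point 0 is left out: it carries no
  mass of \<open>mu\<close>, and Levy densities may be unbounded near it.
\<close>

definition mu :: "real measure" where
  "mu = density (restrict_space lborel {0<..}) (\<lambda>z. ennreal (min 1 z))"

definition mu_abs :: "(real \<Rightarrow> real) \<Rightarrow> real" where
  "mu_abs f = (LINT z|mu. \<bar>f z\<bar>)"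

definition L_mu :: "(real \<Rightarrow> real) set" where
  "L_mu = {f \<in> extensional {0<..}. integrable mu f}"

text \<open>The Borel sigma-algebra of the (semi)norm \<open>mu_abs\<close> on \<open>L_mu\<close>.\<close>

definition borel_L_mu :: "(real \<Rightarrow> real) measure" where
  "borel_L_mu = sigma L_mu
     {U. U \<subseteq> L_mu \<and> (\<forall>f\<in>U. \<exists>e>0. \<forall>g\<in>L_mu. mu_abs (\<lambda>z. g z - f z) < e \<longrightarrow> g \<in> U)}"

definition total_variation :: "real \<Rightarrow> real \<Rightarrow> (real \<Rightarrow> real) \<Rightarrow> ennreal" where
  "total_variation a b f =
     (SUP (m, x) \<in> {(m, x :: nat \<Rightarrow> real). x 0 = a \<and> x m = b \<and> (\<forall>i<m. x i < x (Suc i))}.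
        \<Sum>i<m. ennreal \<bar>f (x (Suc i)) - f (x i)\<bar>)"

definition locally_bv :: "(real \<Rightarrow> real) set" where
  "locally_bv = {f. \<forall>a b. 0 < a \<and> a < b \<longrightarrow> total_variation a b f < \<infinity>}"

definition K_all :: "(real \<Rightarrow> real) set" where
  "K_all = {f \<in> L_mu \<inter> locally_bv. \<forall>z>0. 0 \<le> f z \<and> continuous (at_right z) f}"

text \<open>
  The bounds are imposed modulo \<open>mu\<close>-null sets, that is, on some version \<open>g\<close> of the
  right-continuous function \<open>f\<close>. Imposed on the right-continuous version itself they do not define
  a closed subset of \<open>L_mu\<close>: jumps located slightly to the right of the end point \<open>i + 1\<close> may
  converge to a jump at \<open>i + 1\<close>, which then counts for the interval \<open>[i, i + 1]\<close>; and the
  right-continuous version of a limit may exceed \<open>k\<^sub>R\<close> where \<open>k\<^sub>R\<close> is not right-continuous.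
\<close>

definition K_R :: "(nat \<Rightarrow> real \<Rightarrow> real) \<Rightarrow> nat \<Rightarrow> (real \<Rightarrow> real) set" where
  "K_R kR R = {f \<in> K_all. \<exists>g. (AE z in mu. f z = g z) \<and> (\<forall>z>0. g z \<le> kR R z) \<and>
     (\<forall>i::nat. 1 \<le> i \<longrightarrow>
        max (total_variation (real i) (real (i + 1)) g)
            (total_variation (1 / real (i + 1)) (1 / real i) g) \<le> of_nat R)}"

lemma K_R_pointwise:
  assumes "f \<in> K_all" and "\<And>z. 0 < z \<Longrightarrow> f z \<le> kR R z"
    and "\<And>i::nat. 1 \<le> i \<Longrightarrow>
      max (total_variation (real i) (real (i + 1)) f)
          (total_variation (1 / real (i + 1)) (1 / real i) f) \<le> of_nat R"
  shows "f \<in> K_R kR R"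
  unfolding K_R_def using assms by (intro CollectI conjI exI[of _ f]) auto

definition envelope_sequence :: "(nat \<Rightarrow> real \<Rightarrow> real) \<Rightarrow> bool" where
  "envelope_sequence kR \<longleftrightarrow>
     (\<forall>R\<ge>1. (\<forall>z>0. 0 \<le> kR R z \<and> kR R z \<le> kR (Suc R) z) \<and>
             integrable mu (kR R) \<and> mu_abs (kR R) \<le> real R)"


section \<open>The process\<close>

definition v_flow :: "real \<Rightarrow> real \<Rightarrow> real \<Rightarrow> real \<Rightarrow> real" where
  "v_flow b c t l = b * exp (- b * t) * l / (b + c * l * (1 - exp (- b * t)))"

definition psi :: "real \<Rightarrow> real \<Rightarrow> (real \<Rightarrow> real) \<Rightarrow> real \<Rightarrow> real" where
  "psi b \<beta> k z = b * \<beta> * z + (LINT u:{0<..}|lborel. (1 - exp (- z * u)) * k u)"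

definition cadlag :: "(real \<Rightarrow> real) \<Rightarrow> bool" where
  "cadlag p \<longleftrightarrow> (\<forall>t\<ge>0. continuous (at_right t) p) \<and> (\<forall>t>0. \<exists>l. (p \<longlongrightarrow> l) (at_left t))"

definition brownian_motion :: "'a measure \<Rightarrow> (real \<Rightarrow> 'a \<Rightarrow> real) \<Rightarrow> bool" where
  "brownian_motion M B \<longleftrightarrow>
     (\<forall>t\<ge>0. B t \<in> borel_measurable M) \<and>
     (AE \<omega> in M. B 0 \<omega> = 0 \<and> continuous_on {0..} (\<lambda>t. B t \<omega>)) \<and>
     (\<forall>s t. 0 \<le> s \<and> s < t \<longrightarrow>
        distributed M lborel (\<lambda>\<omega>. B t \<omega> - B s \<omega>) (normal_density 0 (sqrt (t - s)))) \<and>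
     (\<forall>t :: nat \<Rightarrow> real. 0 \<le> t 0 \<and> incseq t \<longrightarrow>
        prob_space.indep_vars M (\<lambda>_. borel) (\<lambda>i \<omega>. B (t (Suc i)) \<omega> - B (t i) \<omega>) UNIV)"

definition poisson_random_measure :: "'a measure \<Rightarrow> 'b measure \<Rightarrow> ('a \<Rightarrow> 'b measure) \<Rightarrow> bool" where
  "poisson_random_measure M \<nu> N \<longleftrightarrow>
     (\<forall>\<omega>\<in>space M. sets (N \<omega>) = sets \<nu>) \<and>
     (\<forall>A\<in>sets \<nu>. (\<lambda>\<omega>. emeasure (N \<omega>) A) \<in> borel_measurable M) \<and>
     (\<forall>A\<in>sets \<nu>. emeasure \<nu> A < \<infinity> \<longrightarrow>
        (\<forall>j::nat. measure M {\<omega> \<in> space M. emeasure (N \<omega>) A = of_nat j} =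
           measure \<nu> A ^ j / fact j * exp (- measure \<nu> A))) \<and>
     (\<forall>A\<in>sets \<nu>. emeasure \<nu> A = \<infinity> \<longrightarrow> (AE \<omega> in M. emeasure (N \<omega>) A = \<infinity>)) \<and>
     (\<forall>A :: nat \<Rightarrow> 'b set. disjoint_family A \<and> range A \<subseteq> sets \<nu> \<longrightarrow>
        prob_space.indep_vars M (\<lambda>_. borel) (\<lambda>i \<omega>. emeasure (N \<omega>) (A i)) UNIV)"

definition levy_measure :: "(real \<Rightarrow> real) \<Rightarrow> real measure" where
  "levy_measure k = density (restrict_space lborel {0<..}) (\<lambda>z. ennreal (k z))"

definition intensity :: "(real \<Rightarrow> real) \<Rightarrow> (real \<times> real) measure" where
  "intensity k = restrict_space lborel {0<..} \<Otimes>\<^sub>M levy_measure k"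

text \<open>
  The stochastic integral of \<open>H\<close> (through its left limits) against \<open>B\<close> over \<open>[0, t]\<close>, as the limit
  in probability of left-point Riemann sums; for adapted cadlag integrands these converge to the
  Ito integral.
\<close>

definition has_ito_integral ::
    "'a measure \<Rightarrow> (real \<Rightarrow> 'a \<Rightarrow> real) \<Rightarrow> (real \<Rightarrow> 'a \<Rightarrow> real) \<Rightarrow> real \<Rightarrow> ('a \<Rightarrow> real) \<Rightarrow> bool" where
  "has_ito_integral M H B t I \<longleftrightarrow> I \<in> borel_measurable M \<and>
     (\<forall>e>0. (\<lambda>m::nat. measure M {\<omega> \<in> space M. e \<le>
        \<bar>(\<Sum>i<m. H (t * real i / real m) \<omega> *
              (B (t * real (Suc i) / real m) \<omega> - B (t * real i / real m) \<omega>)) - I \<omega>\<bar>})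
        \<longlonglongrightarrow> 0)"

text \<open>Events generated by the increments of \<open>B\<close>, and by the points of \<open>N\<close>, after time \<open>s\<close>.\<close>

definition future_B :: "'a measure \<Rightarrow> (real \<Rightarrow> 'a \<Rightarrow> real) \<Rightarrow> real \<Rightarrow> 'a set set" where
  "future_B M B s = sigma_sets (space M)
     {(\<lambda>\<omega>. B t \<omega> - B s \<omega>) -` U \<inter> space M | t U. s \<le> t \<and> U \<in> sets borel}"

definition future_N ::
    "'a measure \<Rightarrow> (real \<times> real) measure \<Rightarrow> ('a \<Rightarrow> (real \<times> real) measure) \<Rightarrow> real \<Rightarrow> 'a set set" where
  "future_N M \<nu> N s = sigma_sets (space M)
     {(\<lambda>\<omega>. emeasure (N \<omega>) A) -` U \<inter> space M | A U.
        A \<in> sets \<nu> \<and> A \<subseteq> {s<..} \<times> {0<..} \<and> U \<in> sets borel}"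

abbreviation path_space :: "(real \<Rightarrow> real) measure" where
  "path_space \<equiv> PiM {0..} (\<lambda>_. borel)"

definition path_from :: "(real \<Rightarrow> 'a \<Rightarrow> real) \<Rightarrow> real \<Rightarrow> 'a \<Rightarrow> real \<Rightarrow> real" where
  "path_from X s \<omega> = (\<lambda>t\<in>{0..}. X (s + t) \<omega>)"

definition shift :: "real \<Rightarrow> (real \<Rightarrow> real) \<Rightarrow> real \<Rightarrow> real" where
  "shift s p = (\<lambda>t\<in>{0..}. p (s + t))"

definition stationary :: "'a measure \<Rightarrow> (real \<Rightarrow> 'a \<Rightarrow> real) \<Rightarrow> bool" where
  "stationary M X \<longleftrightarrow>
     (\<forall>s\<ge>0. distr M path_space (path_from X s) = distr M path_space (path_from X 0))"

definition ergodic :: "'a measure \<Rightarrow> (real \<Rightarrow> 'a \<Rightarrow> real) \<Rightarrow> bool" where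
  "ergodic M X \<longleftrightarrow>
     (\<forall>A\<in>sets path_space. (\<forall>s\<ge>0. shift s -` A \<inter> space path_space = A) \<longrightarrow>
        measure M {\<omega> \<in> space M. path_from X 0 \<omega> \<in> A} \<in> {0, 1})"

abbreviation state_space :: "real measure" where
  "state_space \<equiv> restrict_space borel {0..}"

locale stationary_model = prob_space M + filtration "space M" F
  for M :: "'a measure" and F :: "real \<Rightarrow> 'a measure" +
  fixes B :: "real \<Rightarrow> 'a \<Rightarrow> real" and N :: "'a \<Rightarrow> (real \<times> real) measure"
    and X :: "real \<Rightarrow> 'a \<Rightarrow> real" and P :: "real \<Rightarrow> real \<Rightarrow> real measure"
    and \<eta> :: "real measure" and b \<beta> c :: real and k :: "real \<Rightarrow> real"
  assumes pos: "0 < b" "0 < \<beta>" "0 < c"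
    and k_nonneg: "\<And>z. 0 < z \<Longrightarrow> 0 \<le> k z"
    and k_integrable: "integrable mu k"
    \<comment> \<open>the driving noise\<close>
    and F_sub: "\<And>t. sets (F t) \<subseteq> sets M"
    and B_bm: "brownian_motion M B"
    and B_adapted: "\<And>t. 0 \<le> t \<Longrightarrow> B t \<in> borel_measurable (F t)"
    and N_prm: "poisson_random_measure M (intensity k) N"
    and N_adapted: "\<And>t A. 0 \<le> t \<Longrightarrow> A \<in> sets (intensity k) \<Longrightarrow> A \<subseteq> {0<..t} \<times> {0<..} \<Longrightarrow>
      (\<lambda>\<omega>. emeasure (N \<omega>) A) \<in> borel_measurable (F t)"
    and noise_indep: "\<And>s. 0 \<le> s \<Longrightarrow>
      indep_sets (\<lambda>j. [sets (F s), future_B M B s, future_N M (intensity k) N s] ! j) {..<3::nat}"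
    \<comment> \<open>the stochastic differential equation\<close>
    and X_nonneg: "\<And>t \<omega>. 0 \<le> t \<Longrightarrow> \<omega> \<in> space M \<Longrightarrow> 0 \<le> X t \<omega>"
    and X_adapted: "\<And>t. 0 \<le> t \<Longrightarrow> X t \<in> borel_measurable (F t)"
    and X_cadlag: "AE \<omega> in M. cadlag (\<lambda>t. X t \<omega>)"
    and X_sde: "\<And>t. 0 \<le> t \<Longrightarrow>
      \<exists>I. has_ito_integral M (\<lambda>s \<omega>. sqrt (2 * c * X s \<omega>)) B t I \<and>
        (AE \<omega> in M. integrable (N \<omega>) (\<lambda>(s, z). indicator {0<..t} s * z) \<and>
           X t \<omega> = X 0 \<omega> + (LINT s:{0..t}|lborel. b * (\<beta> - X s \<omega>)) + I \<omega>
                  + (LINT y|N \<omega>. (case y of (s, z) \<Rightarrow> indicator {0<..t} s * z)))"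
    \<comment> \<open>the Markov property and the transition semigroup\<close>
    and P_kernel: "\<And>t. 0 \<le> t \<Longrightarrow> P t \<in> state_space \<rightarrow>\<^sub>M prob_algebra state_space"
    and P_laplace: "\<And>t x l. 0 \<le> t \<Longrightarrow> 0 \<le> x \<Longrightarrow> 0 \<le> l \<Longrightarrow>
      (LINT y|P t x. exp (- l * y)) =
        exp (- x * v_flow b c t l - (LINT s:{0..t}|lborel. psi b \<beta> k (v_flow b c s l)))"
    and X_markov: "\<And>s t A G. 0 \<le> s \<Longrightarrow> 0 \<le> t \<Longrightarrow> A \<in> sets state_space \<Longrightarrow> G \<in> sets (F s) \<Longrightarrow>
      prob {\<omega> \<in> G. X (s + t) \<omega> \<in> A} = (LINT \<omega>:G|M. measure (P t (X s \<omega>)) A)"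
    \<comment> \<open>stationarity and ergodicity; \<open>\<eta>\<close> is the invariant law\<close>
    and X_stationary: "stationary M X"
    and X_marginal: "\<And>t. 0 \<le> t \<Longrightarrow> distr M state_space (X t) = \<eta>"
    and \<eta>_invariant: "\<And>t A. 0 \<le> t \<Longrightarrow> A \<in> sets state_space \<Longrightarrow>
      (LINT x|\<eta>. measure (P t x) A) = measure \<eta> A"
    and \<eta>_laplace: "\<And>l. 0 \<le> l \<Longrightarrow>
      set_integrable lborel {0..} (\<lambda>s. psi b \<beta> k (v_flow b c s l)) \<and>
      (LINT y|\<eta>. exp (- l * y)) = exp (- (LINT s:{0..}|lborel. psi b \<beta> k (v_flow b c s l)))"
    and X_ergodic: "ergodic M X"


section \<open>The estimator\<close>

definition T_op :: "real \<Rightarrow> real \<Rightarrow> (real \<Rightarrow> real) \<Rightarrow> real \<Rightarrow> real" where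
  "T_op b c f l = (LINT s:{0..1}|lborel. LINT z:{0<..}|lborel. (1 - exp (- z * v_flow b c s l)) * f z)"

definition D_fun :: "real \<Rightarrow> real \<Rightarrow> real \<Rightarrow> real \<Rightarrow> real" where
  "D_fun b \<beta> c l = b * \<beta> / c * ln (1 + c * l * (1 - exp (- b)) / b)"

definition L_n :: "real \<Rightarrow> real \<Rightarrow> real \<Rightarrow> nat \<Rightarrow> (nat \<Rightarrow> real) \<Rightarrow> real \<Rightarrow> real" where
  "L_n b \<beta> c n x l =
     1 / real n * (\<Sum>j=1..n. exp (- l * x j + x (j - 1) * v_flow b c 1 l + D_fun b \<beta> c l))"

definition g_n :: "real \<Rightarrow> real \<Rightarrow> real \<Rightarrow> nat \<Rightarrow> (nat \<Rightarrow> real) \<Rightarrow> real \<Rightarrow> real" where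
  "g_n b \<beta> c n x l = - ln (L_n b \<beta> c n x l)"

definition criterion ::
    "real \<Rightarrow> real \<Rightarrow> real \<Rightarrow> (real \<Rightarrow> real) \<Rightarrow> nat \<Rightarrow> (nat \<Rightarrow> real) \<Rightarrow> (real \<Rightarrow> real) \<Rightarrow> real" where
  "criterion b \<beta> c w n x f = (LINT l:{0..}|lborel. \<bar>g_n b \<beta> c n x l - T_op b c f l\<bar>\<^sup>2 * w l)"

definition estimator ::
    "real \<Rightarrow> real \<Rightarrow> real \<Rightarrow> (real \<Rightarrow> real) \<Rightarrow> (nat \<Rightarrow> real \<Rightarrow> real) \<Rightarrow> nat \<Rightarrow> nat \<Rightarrow> (nat \<Rightarrow> real)
      \<Rightarrow> real \<Rightarrow> real" where
  "estimator b \<beta> c w kR R n x = arg_min_on (criterion b \<beta> c w n x) (K_R kR R)"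

text \<open>
  The support of \<open>w\<close> is the support of the measure with density \<open>w\<close>. (The closure of
  \<open>{l. w l \<noteq> 0}\<close> is not invariant under changes of \<open>w\<close> on null sets: it is everything for the
  indicator of the rationals, for which the criterion vanishes identically.)
\<close>

definition weight_support :: "(real \<Rightarrow> real) \<Rightarrow> real set" where
  "weight_support w =
     {l. 0 \<le> l \<and> (\<forall>e>0. 0 < emeasure lborel {y \<in> ball l e. 0 \<le> y \<and> w y \<noteq> 0})}"

definition weight_function :: "(real \<Rightarrow> real) \<Rightarrow> bool" where
  "weight_function w \<longleftrightarrow>
     w \<in> borel_measurable (restrict_space borel {0..}) \<and>
     (\<forall>l\<ge>0. 0 \<le> w l) \<and> (\<exists>C. \<forall>l\<ge>0. w l \<le> C) \<and> compact (weight_support w)"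

text \<open>The sample \<open>X\<^sub>0, \<dots>, X\<^sub>n\<close> of the process at integer times.\<close>

definition sample :: "(real \<Rightarrow> 'a \<Rightarrow> real) \<Rightarrow> nat \<Rightarrow> 'a \<Rightarrow> nat \<Rightarrow> real" where
  "sample X n \<omega> = (\<lambda>j\<in>{..n}. X (real j) \<omega>)"

end

theory Submission
  imports Defs "HOL-Complex_Analysis.Complex_Analysis"
begin

text \<open>
  \<^emph>\<open>Existence.\<close> Helly selection makes \<open>K_R\<close> sequentially compact in \<open>L\<^sup>1(\<mu>)\<close>: versions
  satisfying the bounds everywhere converge pointwise along a subsequence, the bounds pass to the
  limit, and its right limits give the right-continuous version; dominated convergence by \<open>k\<^sub>R\<close>
  gives \<open>L\<^sup>1\<close> convergence, for which the criterion is continuous.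

  \<^emph>\<open>Uniqueness.\<close> \<open>K_R\<close> is convex and the criterion is a squared distance in \<open>L\<^sup>2(w)\<close>, so two
  minimizers \<open>f, h\<close> satisfy \<open>T f = T h\<close> on an interval. With \<open>\<phi>(u) = \<integral> (1 - e\<^sup>-\<^sup>z\<^sup>u) (f - h)(z) dz\<close> and
  \<open>\<Phi>\<close> a primitive of \<open>\<phi>(u) / (b u + c u\<^sup>2)\<close> on the right half plane, the flow equation
  \<open>v' = - (b v + c v\<^sup>2)\<close> gives \<open>T (f - h) = \<Phi> - \<Phi> \<circ> v\<^sub>1\<close>. Hence \<open>\<phi> = \<phi> \<circ> v\<^sub>1\<close> by analytic
  continuation, and \<open>\<phi> = 0\<close> since the iterates of \<open>v\<^sub>1\<close> tend to 0. The derivative of \<open>\<phi>\<close> on a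
  vertical line is a Fourier transform, so \<open>f = h\<close> almost everywhere.

  \<^emph>\<open>Measurability.\<close> The minimizer lies in a closed set \<open>C\<close> iff the infima of the criterion over
  countable dense subsets of \<open>C \<inter> K_R\<close> and of \<open>K_R\<close> agree.
\<close>

section \<open>Functions of bounded variation\<close>

text \<open>The variation and envelope bounds belong to an arbitrary version, not to the
  right-continuous representative. Helly selection is therefore run on the versions and must give
  convergence at every point of the half line, since the end points of closed intervals count for
  the variation. The representative of the limit is built afterwards and is only claimed to be
  locally of bounded variation. Variation is handled through a real function \<open>W\<close> with
  |g y - g x| <= W y - W x for x <= y. On the interval \<open>W\<close> and \<open>W - g\<close> are
  then nondecreasing, a Jordan decomposition that serves for one-sided limits, for countability of
  the discontinuities and for the selection step. In the uniqueness part the obstacle is the time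
  average in \<open>T_op\<close>, to which Laplace inversion does not apply directly. The field b u
  + c u^2 vanishes only at 0 and -b/c, outside the open right half plane, so dividing by it is
  harmless; and the time-one flow carries this field to itself, so differentiating Phi - Phi o v_1
  leaves a difference of two exponents over one common denominator.\<close>

definition variation_dominated :: "(real \<Rightarrow> real) \<Rightarrow> (real \<Rightarrow> real) \<Rightarrow> real \<Rightarrow> real \<Rightarrow> bool" where
  "variation_dominated g W a b \<longleftrightarrow>
     (\<forall>x y. a \<le> x \<and> x \<le> y \<and> y \<le> b \<longrightarrow> \<bar>g y - g x\<bar> \<le> W y - W x)"

lemma variation_dominatedD:
  assumes "variation_dominated g W a b" "a \<le> x" "x \<le> y" "y \<le> b"
  shows "\<bar>g y - g x\<bar> \<le> W y - W x"
  using assms unfolding variation_dominated_def by blast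

lemma variation_dominated_mono:
  assumes "variation_dominated g W a b" "a \<le> x" "x \<le> y" "y \<le> b"
  shows "W x \<le> W y" "W x - g x \<le> W y - g y"
  using variation_dominatedD[OF assms] by auto

lemma total_variation_ge:
  assumes "x 0 = a" "x m = b" "\<And>i. i < m \<Longrightarrow> x i < x (Suc i)"
  shows "(\<Sum>i<m. ennreal \<bar>f (x (Suc i)) - f (x i)\<bar>) \<le> total_variation a b f"
  unfolding total_variation_def
  by (rule SUP_upper2[of "(m, x)"]) (use assms in auto)

lemma total_variation_leI:
  assumes "\<And>m x. x 0 = a \<Longrightarrow> x m = b \<Longrightarrow> (\<And>i. i < m \<Longrightarrow> x i < x (Suc i)) \<Longrightarrow>
     (\<Sum>i<m. ennreal \<bar>f (x (Suc i)) - f (x i)\<bar>) \<le> C"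
  shows "total_variation a b f \<le> C"
  unfolding total_variation_def by (rule SUP_least) (use assms in auto)

lemma partition_le:
  fixes x :: "nat \<Rightarrow> real"
  assumes "\<And>i. i < m \<Longrightarrow> x i < x (Suc i)" "i \<le> j" "j \<le> m"
  shows "x i \<le> x j"
  using assms(2,3)
proof (induction j rule: dec_induct)
  case (step n)
  then show ?case using assms(1)[of n] by auto
qed simp

text \<open>A partition of [a, x] extended by the point y is a partition of [a, y].\<close>

lemma total_variation_append:
  assumes "a < x" "x < y"
  shows "total_variation a x f + ennreal \<bar>f y - f x\<bar> \<le> total_variation a y f"
proof -
  let ?S = "{(m, u :: nat \<Rightarrow> real). u 0 = a \<and> u m = x \<and> (\<forall>i<m. u i < u (Suc i))}"
  \<comment> \<open>In \<open>ennreal\<close> a constant moves into a supremum only over a nonempty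
    index set; the one-step partition is a witness.\<close>
  have "(1, \<lambda>i::nat. if i = 0 then a else x) \<in> ?S" using assms by auto
  then have ne: "?S \<noteq> {}" by blast
  have "(\<Sum>i<m. ennreal \<bar>f (u (Suc i)) - f (u i)\<bar>) + ennreal \<bar>f y - f x\<bar> \<le> total_variation a y f"
    if "u 0 = a" "u m = x" "\<forall>i<m. u i < u (Suc i)" for m u
  proof -
    define v where "v = u(Suc m := y)"
    have "(\<Sum>i<Suc m. ennreal \<bar>f (v (Suc i)) - f (v i)\<bar>) \<le> total_variation a y f"
      by (rule total_variation_ge) (use that assms in \<open>auto simp: v_def less_Suc_eq\<close>)
    moreover have "(\<Sum>i<m. ennreal \<bar>f (v (Suc i)) - f (v i)\<bar>) = (\<Sum>i<m. ennreal \<bar>f (u (Suc i)) - f (u i)\<bar>)"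
      by (intro sum.cong) (auto simp: v_def)
    ultimately show ?thesis using that by (simp add: v_def)
  qed
  then show ?thesis
    unfolding total_variation_def[of a x] ennreal_SUP_add_left[OF ne, symmetric]
    by (intro SUP_least) auto
qed

lemma total_variation_imp_dominated:
  assumes "total_variation a b f \<le> ennreal C" "a < b" "0 \<le> C"
  obtains W where "variation_dominated f W a b" "W a = 0" "W b \<le> C"
proof -
  \<comment> \<open>The variation of \<open>f\<close> up to x as a real number.
    \<open>enn2real\<close> sends infinity to 0, so \<open>fin\<close> is what makes its values
    comparable.\<close>
  define W where "W x = (if x \<le> a then 0 else enn2real (total_variation a x f))" for x
  have mono: "total_variation a x f \<le> total_variation a b f" if "a < x" "x \<le> b" for x
    using total_variation_append[of a x b f] that
    by (cases "x = b") (auto intro: order_trans[OF add_increasing2[OF _ order_refl]])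
  have fin: "total_variation a x f < top" if "a < x" "x \<le> b" for x
    using mono[OF that] assms(1) by (meson ennreal_less_top order.strict_trans1 order_trans)
  have step: "\<bar>f y - f x\<bar> \<le> W y - W x" if "a \<le> x" "x < y" "y \<le> b" for x y
  proof (cases "x = a")
    case True
    have "(\<Sum>i<1. ennreal \<bar>f ((if Suc i = 0 then a else y)) - f (if i = 0 then a else y)\<bar>) \<le> total_variation a y f"
      by (rule total_variation_ge) (use that True in auto)
    then have "ennreal \<bar>f y - f a\<bar> \<le> total_variation a y f" by simp
    then have "\<bar>f y - f a\<bar> \<le> enn2real (total_variation a y f)"
      using fin[of y] that by (cases "total_variation a y f") (auto simp: )
    then show ?thesis using True that by (simp add: W_def)
  next
    case False
    have "total_variation a x f + ennreal \<bar>f y - f x\<bar> \<le> total_variation a y f"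
      using total_variation_append that False by auto
    then show ?thesis using fin[of x] fin[of y] that False
      by (cases "total_variation a x f"; cases "total_variation a y f")
         (auto simp: W_def simp flip: ennreal_plus)
  qed
  have "variation_dominated f W a b"
    unfolding variation_dominated_def using step by (metis abs_zero diff_self dual_order.refl order_le_less)
  moreover have "W a = 0" by (simp add: W_def)
  moreover have "W b \<le> C" using assms fin[of b]
    by (cases "total_variation a b f") (auto simp: W_def)
  ultimately show ?thesis using that by blast
qed

lemma variation_dominated_sum:
  assumes "variation_dominated f W a b" "a \<le> x 0" "x m \<le> b"
    "\<And>i. i < m \<Longrightarrow> x i < x (Suc i)"
  shows "(\<Sum>i<m. \<bar>f (x (Suc i)) - f (x i)\<bar>) \<le> W (x m) - W (x 0)"
proof -
  have "(\<Sum>i<m. \<bar>f (x (Suc i)) - f (x i)\<bar>) \<le> (\<Sum>i<m. W (x (Suc i)) - W (x i))"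
  proof (intro sum_mono variation_dominatedD[OF assms(1)])
    fix i assume i: "i \<in> {..<m}"
    show "a \<le> x i" using partition_le[of m x 0 i] assms(2,4) i by auto
    show "x i \<le> x (Suc i)" using assms(4)[of i] i by auto
    show "x (Suc i) \<le> b" using partition_le[of m x "Suc i" m] assms(3,4) i by auto
  qed
  also have "\<dots> = W (x m) - W (x 0)" by (rule sum_lessThan_telescope)
  finally show ?thesis .
qed

text \<open>\<open>W'\<close> is raised by \<open>W b\<close> so that the pieces fit together; an
  increment across b is split there by the triangle inequality.\<close>

lemma variation_dominated_join:
  assumes "variation_dominated f W a b" "variation_dominated f W' b d" "W a = 0" "W b \<le> C"
    "W' b = 0" "W' d \<le> C'" "a \<le> b" "b \<le> d"
  obtains W'' where "variation_dominated f W'' a d" "W'' a = 0" "W'' d \<le> C + C'"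
proof
  define W'' where "W'' x = (if x \<le> b then W x else W b + W' x)" for x
  show "variation_dominated f W'' a d"
    unfolding variation_dominated_def
  proof (intro allI impI)
    fix x y assume xy: "a \<le> x \<and> x \<le> y \<and> y \<le> d"
    consider "y \<le> b" | "b < x" | "x \<le> b" "b < y" by linarith
    then show "\<bar>f y - f x\<bar> \<le> W'' y - W'' x"
    proof cases
      case 1 then show ?thesis using variation_dominatedD[OF assms(1), of x y] xy by (simp add: W''_def)
    next
      case 2 then show ?thesis using variation_dominatedD[OF assms(2), of x y] xy by (simp add: W''_def)
    next
      case 3 then show ?thesis
        using variation_dominatedD[OF assms(1), of x b] variation_dominatedD[OF assms(2), of b y] xy assms(5)
        by (simp add: W''_def)
    qed
  qed
  show "W'' a = 0" using assms by (simp add: W''_def)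
  show "W'' d \<le> C + C'" using assms by (auto simp: W''_def)
qed

section \<open>Variation bounds on an exhaustion of the half line\<close>

definition variation_bounds :: "nat \<Rightarrow> (real \<Rightarrow> real) \<Rightarrow> bool" where
  "variation_bounds R g \<longleftrightarrow> (\<forall>i::nat. 1 \<le> i \<longrightarrow>
        max (total_variation (real i) (real (i + 1)) g)
            (total_variation (1 / real (i + 1)) (1 / real i) g) \<le> of_nat R)"

text \<open>For i = 1, ..., m the intervals [i, i + 1] and [1 / (i + 1), 1 / i] tile
  [1 / (m + 1), m + 1]; each of the 2 m pieces contributes at most R.\<close>

lemma variation_bounds_imp_dominated:
  assumes "variation_bounds R g"
  shows "\<exists>W. variation_dominated g W (1 / real (Suc m)) (real (Suc m)) \<and>
    W (1 / real (Suc m)) = 0 \<and> W (real (Suc m)) \<le> 2 * real m * real R"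
proof (induction m)
  case 0
  \<comment> \<open>Here the interval is the single point 1.\<close>
  show ?case by (rule exI[of _ "\<lambda>_. 0"]) (auto simp: variation_dominated_def dest: antisym[OF order_trans])
next
  case (Suc m)
  then obtain W where W: "variation_dominated g W (1 / real (Suc m)) (real (Suc m))"
    "W (1 / real (Suc m)) = 0" "W (real (Suc m)) \<le> 2 * real m * real R" by blast
  have 1: "total_variation (real (Suc m)) (real (Suc (Suc m))) g \<le> ennreal (real R)"
    "total_variation (1 / real (Suc (Suc m))) (1 / real (Suc m)) g \<le> ennreal (real R)"
    using assms[unfolded variation_bounds_def, rule_format, of "Suc m"]
    by (auto simp: ennreal_of_nat_eq_real_of_nat algebra_simps)
  obtain W1 where W1: "variation_dominated g W1 (real (Suc m)) (real (Suc (Suc m)))"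
     "W1 (real (Suc m)) = 0" "W1 (real (Suc (Suc m))) \<le> real R"
    by (rule total_variation_imp_dominated[OF 1(1)]) auto
  obtain W2 where W2: "variation_dominated g W2 (1 / real (Suc (Suc m))) (1 / real (Suc m))"
     "W2 (1 / real (Suc (Suc m))) = 0" "W2 (1 / real (Suc m)) \<le> real R"
    by (rule total_variation_imp_dominated[OF 1(2)]) (auto simp: field_simps)
  have le1: "1 / real (Suc m) \<le> real (Suc m)" by (simp add: field_simps)
  have le2: "1 / real (Suc (Suc m)) \<le> 1 / real (Suc m)" by (simp add: field_simps)
  have le3: "real (Suc m) \<le> real (Suc (Suc m))" by simp
  obtain W3 where W3: "variation_dominated g W3 (1 / real (Suc (Suc m))) (real (Suc m))"
    "W3 (1 / real (Suc (Suc m))) = 0" "W3 (real (Suc m)) \<le> real R + 2 * real m * real R"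
    by (rule variation_dominated_join[OF W2(1) W(1) W2(2,3) W(2,3) le2 le1])
  obtain W4 where "variation_dominated g W4 (1 / real (Suc (Suc m))) (real (Suc (Suc m)))"
    "W4 (1 / real (Suc (Suc m))) = 0" "W4 (real (Suc (Suc m))) \<le> (real R + 2 * real m * real R) + real R"
    by (rule variation_dominated_join[OF W3(1) W1(1) W3(2,3) W1(2,3) order_trans[OF le2 le1] le3])
  then show ?case by (intro exI[of _ W4]) (auto simp: algebra_simps)
qed

lemma obtain_symmetric_interval:
  fixes x :: real assumes "0 < x"
  obtains m :: nat where "1 / real (Suc m) < x" "x < real (Suc m)"
proof -
  obtain m :: nat where m: "max x (1/x) < real m" using reals_Archimedean2 by blast
  then have "x < real (Suc m)" "1 / x < real (Suc m)" by auto
  then show ?thesis using assms by (intro that[of m]) (auto simp: field_simps)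
qed

text \<open>The diagonal argument in \<open>function_convergent_subsequence\<close> wants one bound
  for all points; division by 1 + |C x|, which never vanishes, turns the pointwise bound into the
  bound 1.\<close>

lemma convergent_subsequence_countable:
  fixes f :: "nat \<Rightarrow> 'i \<Rightarrow> real"
  assumes "countable S" "\<And>n x. x \<in> S \<Longrightarrow> \<bar>f n x\<bar> \<le> C x"
  obtains r where "strict_mono (r::nat \<Rightarrow> nat)" "\<And>x. x \<in> S \<Longrightarrow> convergent (\<lambda>n. f (r n) x)"
proof -
  have "norm (f n x / (1 + \<bar>C x\<bar>)) \<le> 1" if "x \<in> S" for n x
    using assms(2)[OF that, of n] by (auto simp: field_simps)
  then obtain r where r: "strict_mono (r::nat \<Rightarrow> nat)" "\<And>x. x \<in> S \<Longrightarrow> \<exists>l. (\<lambda>n. f (r n) x / (1 + \<bar>C x\<bar>)) \<longlonglongrightarrow> l"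
    using function_convergent_subsequence[OF assms(1), of "\<lambda>n x. f n x / (1 + \<bar>C x\<bar>)" 1] by metis
  have "convergent (\<lambda>n. f (r n) x)" if x: "x \<in> S" for x
  proof -
    obtain l where "(\<lambda>n. f (r n) x / (1 + \<bar>C x\<bar>)) \<longlonglongrightarrow> l" using r(2)[OF x] by blast
    from tendsto_mult_right[OF this, of "1 + \<bar>C x\<bar>"]
    show ?thesis by (auto simp: convergent_def add_nonneg_eq_0_iff intro!: exI split: if_splits)
  qed
  with r show ?thesis using that by blast
qed

section \<open>Helly selection\<close>

text \<open>The limit of \<open>W n\<close> on the rationals extends to a nondecreasing function.
  Where that function is continuous, \<open>W n\<close> eventually has a small increment across x,
  so \<open>g n x\<close> stays uniformly close to the value at a nearby rational and the sequence
  is Cauchy. Exceptional points are thus discontinuities of a monotone function.\<close>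

lemma helly_on_interval:
  fixes g W :: "nat \<Rightarrow> real \<Rightarrow> real"
  assumes dom: "\<And>n. variation_dominated (g n) (W n) a b"
    and convg: "\<And>q. q \<in> \<rat> \<Longrightarrow> a < q \<Longrightarrow> q < b \<Longrightarrow> convergent (\<lambda>n. g n q)"
    and convW: "\<And>q. q \<in> \<rat> \<Longrightarrow> a < q \<Longrightarrow> q < b \<Longrightarrow> convergent (\<lambda>n. W n q)"
    and bdd: "\<And>n x. a \<le> x \<Longrightarrow> x \<le> b \<Longrightarrow> W n x \<le> C"
  shows "countable {x. a < x \<and> x < b \<and> \<not> convergent (\<lambda>n. g n x)}"
proof -
  define V where "V q = lim (\<lambda>n. W n q)" for q
  have V: "(\<lambda>n. W n q) \<longlonglongrightarrow> V q" if "q \<in> \<rat>" "a < q" "q < b" for q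
    using convW[OF that] by (simp add: V_def convergent_LIMSEQ_iff)
  have V_mono: "V p \<le> V q" if "p \<in> \<rat>" "q \<in> \<rat>" "a < p" "p \<le> q" "q < b" for p q
    by (rule LIMSEQ_le[OF V V]) (use that variation_dominated_mono[OF dom, of p q] in auto)
  \<comment> \<open>Extension of \<open>V\<close> from the rationals by suprema from the left; by
    monotonicity it agrees with \<open>V\<close> on the rationals (\<open>U_rat\<close>).\<close>
  define U where "U x = Sup (V ` {q \<in> \<rat>. a < q \<and> q \<le> x})" for x
  have bdd_V: "bdd_above (V ` {q \<in> \<rat>. a < q \<and> q \<le> x})" if "x < b" for x
  proof (rule bdd_aboveI2)
    fix q assume "q \<in> {q \<in> \<rat>. a < q \<and> q \<le> x}"
    then show "V q \<le> C" using that by (intro LIMSEQ_le_const2[OF V]) (auto intro!: bdd exI[of _ 0])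
  qed
  have U_mono: "mono_on {a<..<b} U"
  proof (rule mono_onI)
    fix x y assume xy: "x \<in> {a<..<b}" "y \<in> {a<..<b}" "x \<le> y"
    obtain q where "q \<in> \<rat>" "a < q" "q < x" using Rats_dense_in_real[of a x] xy by auto
    then show "U x \<le> U y" unfolding U_def
      using xy bdd_V[of y] by (intro cSup_subset_mono) auto
  qed
  have U_rat: "U q = V q" if "q \<in> \<rat>" "a < q" "q < b" for q
    unfolding U_def using that V_mono by (intro cSup_eq_maximum) auto
  have "convergent (\<lambda>n. g n x)" if x: "a < x" "x < b" "isCont U x" for x
  proof (rule Cauchy_convergent, rule CauchyI)
    fix e :: real assume e: "0 < e"
    \<comment> \<open>Two errors e / 8, at p and at q, give V q - V p < e / 4; the final three-term
      estimate then stays below 3 e / 4.\<close>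
    obtain d where d: "0 < d" "\<And>y. \<bar>y - x\<bar> < d \<Longrightarrow> \<bar>U y - U x\<bar> < e / 8"
      using x(3) e unfolding continuous_at_eps_delta dist_real_def
      by (meson divide_pos_pos zero_less_numeral)
    obtain p where p: "p \<in> \<rat>" "max a (x - d) < p" "p < x"
      using Rats_dense_in_real[of "max a (x - d)" x] x d(1) by auto
    obtain q where q: "q \<in> \<rat>" "x < q" "q < min b (x + d)"
      using Rats_dense_in_real[of x "min b (x + d)"] x d(1) by auto
    have pq: "a < p" "p < b" "a < q" "q < b" using p q x by auto
    have "V q - V p < e / 4"
      using d(2)[of p, unfolded abs_less_iff] d(2)[of q, unfolded abs_less_iff] p q
        U_rat[of p] U_rat[of q] pq e by auto
    moreover have "(\<lambda>n. W n q - W n p) \<longlonglongrightarrow> V q - V p"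
      by (intro tendsto_diff V) (use p q pq in auto)
    ultimately have "eventually (\<lambda>n. W n q - W n p < e / 4) sequentially"
      by (rule order_tendstoD(2)[rotated])
    moreover have "Cauchy (\<lambda>n. g n p)" using convg[of p] p pq by (simp add: Cauchy_convergent_iff)
    ultimately obtain N N' where
      N: "\<And>n. N \<le> n \<Longrightarrow> W n q - W n p < e / 4"
      and N': "\<And>m n. N' \<le> m \<Longrightarrow> N' \<le> n \<Longrightarrow> norm (g m p - g n p) < e / 4"
      using e unfolding eventually_sequentially Cauchy_iff by (meson divide_pos_pos zero_less_numeral)
    have close: "\<bar>g n x - g n p\<bar> < e / 4" if "N \<le> n" for n
    proof -
      have "\<bar>g n x - g n p\<bar> \<le> W n x - W n p" 
        using p q x pq by (intro variation_dominatedD[OF dom]) auto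
      also have "\<dots> \<le> W n q - W n p"
        using variation_dominated_mono(1)[OF dom, of x q n] p q x pq by auto
      finally show ?thesis using N[OF that] by linarith
    qed
    show "\<exists>M. \<forall>m\<ge>M. \<forall>n\<ge>M. norm (g m x - g n x) < e"
    proof (intro exI[of _ "max N N'"] allI impI)
      fix m n assume "max N N' \<le> m" "max N N' \<le> n"
      then have "\<bar>g m x - g m p\<bar> < e / 4" "\<bar>g n x - g n p\<bar> < e / 4" "\<bar>g m p - g n p\<bar> < e / 4"
        using close[of m] close[of n] N'[of m n] by auto
      then show "norm (g m x - g n x) < e"
        unfolding real_norm_def by linarith
    qed
  qed
  then have "{x. a < x \<and> x < b \<and> \<not> convergent (\<lambda>n. g n x)} \<subseteq> {x \<in> {a<..<b}. \<not> isCont U x}"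
    by (simp only: Collect_mono_iff greaterThanLessThan_iff) blast
  then show ?thesis
    using mono_on_ctble_discont_open[OF open_greaterThanLessThan U_mono] countable_subset by blast
qed

text \<open>
  A first diagonal subsequence converges on the rationals, together with the dominating functions,
  hence off a countable set; a second one takes care of that set.
\<close>

lemma helly_pointwise:
  fixes g :: "nat \<Rightarrow> real \<Rightarrow> real"
  assumes bounds: "\<And>n. variation_bounds R (g n)"
    and bdd: "\<And>n x. 0 < x \<Longrightarrow> \<bar>g n x\<bar> \<le> C x"
  obtains r where "strict_mono (r :: nat \<Rightarrow> nat)" "\<And>x. 0 < x \<Longrightarrow> convergent (\<lambda>n. g (r n) x)"
proof -
  define lo hi where "lo m = 1 / real (Suc m)" and "hi m = real (Suc m)" for m
  have "\<forall>n m. \<exists>W. variation_dominated (g n) W (lo m) (hi m) \<and> W (lo m) = 0 \<and>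
      W (hi m) \<le> 2 * real m * real R"
    using variation_bounds_imp_dominated[OF bounds] unfolding lo_def hi_def by blast
  then obtain W where W: "\<And>n m. variation_dominated (g n) (W n m) (lo m) (hi m)"
      "\<And>n m. W n m (lo m) = 0" "\<And>n m. W n m (hi m) \<le> 2 * real m * real R"
    by metis
  have W_bdd: "0 \<le> W n m x \<and> W n m x \<le> 2 * real m * real R" if "lo m \<le> x" "x \<le> hi m" for n m x
    using variation_dominated_mono(1)[OF W(1)[of n m], of "lo m" x]
      variation_dominated_mono(1)[OF W(1)[of n m], of x "hi m"] W(2,3)[of n m] that by linarith
  \<comment> \<open>One index set for all sequences that must converge: \<open>None\<close> labels
    \<open>g\<close>, \<open>Some m\<close> labels the dominating function on the m-th interval. The
    value 0 elsewhere makes one bound valid at every index.\<close>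
  define S where "S = insert None (Some ` (UNIV :: nat set)) \<times> (\<rat> :: real set)"
  define h where "h n = (\<lambda>(k, q). case k of None \<Rightarrow> if 0 < q then g n q else 0
      | Some m \<Rightarrow> if lo m \<le> q \<and> q \<le> hi m then W n m q else 0)" for n
  have "countable S" unfolding S_def by (intro countable_SIGMA countable_insert countable_image) (simp_all add: countable_rat)
  moreover have "\<bar>h n s\<bar> \<le> (case s of (k, q) \<Rightarrow> case k of None \<Rightarrow> \<bar>C q\<bar> | Some m \<Rightarrow> 2 * real m * real R)"
    for n and s :: "nat option \<times> real"
  proof (cases s)
    case (Pair k q)
    show ?thesis
    proof (cases k)
      case None
      then show ?thesis using Pair order_trans[OF bdd[of q n] abs_ge_self[of "C q"]] by (simp add: h_def)
    next
      case (Some m)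
      then show ?thesis using Pair W_bdd[of m q n] by (simp add: h_def)
    qed
  qed
  ultimately obtain r1 where r1: "strict_mono (r1 :: nat \<Rightarrow> nat)"
      "\<And>s. s \<in> S \<Longrightarrow> convergent (\<lambda>n. h (r1 n) s)"
    using convergent_subsequence_countable[of S h] by metis
  define E where "E = (\<Union>m. {x. lo m < x \<and> x < hi m \<and> \<not> convergent (\<lambda>n. g (r1 n) x)})"
  have pos: "0 < lo m" for m by (simp add: lo_def)
  have "countable {x. lo m < x \<and> x < hi m \<and> \<not> convergent (\<lambda>n. g (r1 n) x)}" for m
  proof (rule helly_on_interval[where W = "\<lambda>n. W (r1 n) m" and C = "2 * real m * real R"])
    show "variation_dominated (g (r1 n)) (W (r1 n) m) (lo m) (hi m)" for n by (rule W)
    show "W (r1 n) m x \<le> 2 * real m * real R" if "lo m \<le> x" "x \<le> hi m" for n x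
      using W_bdd that by blast
    fix q assume q: "q \<in> \<rat>" "lo m < q" "q < hi m"
    show "convergent (\<lambda>n. g (r1 n) q)"
      using r1(2)[of "(None, q)"] q pos[of m] by (auto simp: S_def h_def)
    show "convergent (\<lambda>n. W (r1 n) m q)"
      using r1(2)[of "(Some m, q)"] q by (auto simp: S_def h_def)
  qed
  then have "countable E" unfolding E_def by blast
  moreover have "\<bar>g (r1 n) x\<bar> \<le> C x" if "x \<in> E" for n x
    using that pos by (intro bdd) (auto simp: E_def intro: less_trans)
  ultimately obtain r2 where r2: "strict_mono (r2 :: nat \<Rightarrow> nat)"
      "\<And>x. x \<in> E \<Longrightarrow> convergent (\<lambda>n. g (r1 (r2 n)) x)"
    using convergent_subsequence_countable[of E "\<lambda>n. g (r1 n)" C] by metis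
  have "convergent (\<lambda>n. g ((r1 \<circ> r2) n) x)" if x: "0 < x" for x
  proof (cases "x \<in> E")
    case True then show ?thesis using r2(2) by simp
  next
    case False
    obtain m where "lo m < x" "x < hi m"
      using obtain_symmetric_interval[OF x] unfolding lo_def hi_def by blast
    with False have "convergent (\<lambda>n. g (r1 n) x)" unfolding E_def by blast
    then show ?thesis using convergent_subseq_convergent[OF _ r2(1)] by (auto simp: o_def)
  qed
  then show ?thesis using that strict_mono_o[OF r1(1) r2(1)] by blast
qed

text \<open>Lower semicontinuity of the variation: each partition sum involves finitely many points,
  among them the end points, and passes to the limit.\<close>

lemma total_variation_limit_le:
  assumes "\<And>x. a \<le> x \<Longrightarrow> x \<le> b \<Longrightarrow> (\<lambda>n. g n x) \<longlonglongrightarrow> f x" "\<And>n. total_variation a b (g n) \<le> C"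
  shows "total_variation a b f \<le> C"
proof (rule total_variation_leI)
  fix m and x :: "nat \<Rightarrow> real" assume x: "x 0 = a" "x m = b" "\<And>i. i < m \<Longrightarrow> x i < x (Suc i)"
  have mem: "a \<le> x i" "x i \<le> b" if "i \<le> m" for i
    using partition_le[of m x 0 i] partition_le[of m x i m] x that by auto
  have "(\<lambda>n. \<Sum>i<m. ennreal \<bar>g n (x (Suc i)) - g n (x i)\<bar>) \<longlonglongrightarrow> (\<Sum>i<m. ennreal \<bar>f (x (Suc i)) - f (x i)\<bar>)"
    by (intro tendsto_sum tendsto_ennrealI tendsto_intros assms(1)) (auto intro!: mem)
  moreover have "(\<Sum>i<m. ennreal \<bar>g n (x (Suc i)) - g n (x i)\<bar>) \<le> C" for n
    using total_variation_ge[OF x(1,2,3)] assms(2) order_trans by blast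
  ultimately show "(\<Sum>i<m. ennreal \<bar>f (x (Suc i)) - f (x i)\<bar>) \<le> C"
    by (intro LIMSEQ_le_const2[of "\<lambda>n. \<Sum>i<m. ennreal \<bar>g n (x (Suc i)) - g n (x i)\<bar>"]) blast+
qed

lemma variation_bounds_limit:
  assumes "\<And>x. 0 < x \<Longrightarrow> (\<lambda>n. g n x) \<longlonglongrightarrow> f x" "\<And>n. variation_bounds R (g n)"
  shows "variation_bounds R f"
  unfolding variation_bounds_def
proof (intro allI impI max.boundedI)
  fix i :: nat assume i: "1 \<le> i"
  show "total_variation (real i) (real (i + 1)) f \<le> of_nat R"
    by (rule total_variation_limit_le[of _ _ g])
      (use i assms in \<open>auto simp: variation_bounds_def\<close>)
  have "0 < x" if "1 / real (i + 1) \<le> x" for x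
    using that by (rule less_le_trans[rotated]) simp
  then have "(\<lambda>n. g n x) \<longlonglongrightarrow> f x" if "1 / real (i + 1) \<le> x" for x
    using assms(1) that by blast
  moreover have "total_variation (1 / real (i + 1)) (1 / real i) (g n) \<le> of_nat R" for n
    using assms(2)[of n] i unfolding variation_bounds_def by auto
  ultimately show "total_variation (1 / real (i + 1)) (1 / real i) f \<le> of_nat R"
    by (rule total_variation_limit_le)
qed

section \<open>Right-continuous functions and the measure \<open>mu\<close>\<close>

lemma sets_mu [measurable_cong]: "sets mu = sets (restrict_space borel {0<..})"
  unfolding mu_def by (simp cong: sets_restrict_space_cong)

lemma space_mu [simp]: "space mu = {0<..}"
  unfolding mu_def by (simp add: space_restrict_space)

lemma measurable_mu_iff:
  fixes f :: "real \<Rightarrow> 'b::real_normed_vector"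
  shows "f \<in> borel_measurable mu \<longleftrightarrow> (\<lambda>z. indicator {0<..} z *\<^sub>R f z) \<in> borel_measurable borel"
  by (subst measurable_cong_sets[OF sets_mu refl])
    (simp add: borel_measurable_restrict_space_iff)

lemma borel_measurable_mu:
  "f \<in> borel_measurable borel \<Longrightarrow> f \<in> borel_measurable mu"
  by (subst measurable_cong_sets[OF sets_mu refl]) (rule measurable_restrict_space1)

lemma AE_mu_iff: "(AE z in mu. P z) \<longleftrightarrow> (AE z in lborel. 0 < z \<longrightarrow> P z)"
proof -
  have [measurable]: "(\<lambda>z::real. ennreal (min 1 z)) \<in> borel_measurable (restrict_space lborel {0<..})"
    by (rule measurable_restrict_space1) measurable
  have "(AE z in mu. P z) \<longleftrightarrow> (AE z in restrict_space lborel {0<..}. 0 < ennreal (min 1 z) \<longrightarrow> P z)"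
    unfolding mu_def by (rule AE_density) measurable
  also have "\<dots> \<longleftrightarrow> (AE z in lborel. 0 < z \<longrightarrow> 0 < ennreal (min 1 z) \<longrightarrow> P z)"
    by (subst AE_restrict_space_iff) auto
  also have "\<dots> \<longleftrightarrow> (AE z in lborel. 0 < z \<longrightarrow> P z)"
    by (intro AE_cong_simp) auto
  finally show ?thesis .
qed


text \<open>A nonempty open interval has positive measure, so it cannot miss a set of full
  measure.\<close>

lemma AE_mu_point:
  assumes "AE z in mu. P z" "0 < x" "x < y"
  obtains z where "x < z" "z < y" "P z"
proof -
  have "AE z in lborel. 0 < z \<longrightarrow> P z" using assms(1) by (simp add: AE_mu_iff)
  then have "\<exists>z\<in>{x<..<y}. P z"
  proof (rule contrapos_pp)
    assume none: "\<not> (\<exists>z\<in>{x<..<y}. P z)"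
    show "\<not> (AE z in lborel. 0 < z \<longrightarrow> P z)"
    proof
      assume "AE z in lborel. 0 < z \<longrightarrow> P z"
      then have "AE z in lborel. z \<notin> {x<..<y}"
        by (rule AE_mp) (use none assms(2) in \<open>auto intro!: AE_I2\<close>)
      then have "emeasure lborel {x<..<y} = 0"
        by (subst (asm) AE_iff_null_sets[symmetric]) auto
      then show False using assms(3) by simp
    qed
  qed
  then show ?thesis using that by auto
qed

text \<open>If f x lay in the open complement of \<open>A\<close>, so would all values on some
  interval to the right of x. This upgrades almost-everywhere statements about right-continuous
  functions to statements at every point.\<close>

lemma AE_mu_right_continuous:
  fixes f :: "real \<Rightarrow> real"
  assumes "AE z in mu. f z \<in> A" "closed A" "continuous (at_right x) f" "0 < x"
  shows "f x \<in> A"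
proof (rule ccontr)
  assume "f x \<notin> A"
  then have "eventually (\<lambda>y. f y \<in> - A) (at_right x)"
    using assms(2,3) unfolding continuous_within
    by (intro topological_tendstoD) (auto simp: open_Compl)
  then obtain y where y: "x < y" "\<And>z. x < z \<Longrightarrow> z < y \<Longrightarrow> f z \<notin> A"
    unfolding eventually_at_right_field by auto
  then show False using AE_mu_point[OF assms(1,4) y(1)] by metis
qed

lemma right_continuous_eq:
  fixes f g :: "real \<Rightarrow> real"
  assumes "AE z in mu. f z = g z" "0 < x"
    "continuous (at_right x) f" "continuous (at_right x) g"
  shows "f x = g x"
  using AE_mu_right_continuous[of "\<lambda>z. f z - g z" "{0}" x] assms
  by (auto intro: continuous_diff)

text \<open>\<open>f\<close> is the limit of its values at the grid points strictly to the right.\<close>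

lemma right_continuous_measurable_mu:
  fixes f :: "real \<Rightarrow> real"
  assumes "\<And>z. 0 < z \<Longrightarrow> continuous (at_right z) f"
  shows "f \<in> borel_measurable mu"
proof (rule borel_measurable_LIMSEQ_real)
  define p where "p n z = (of_int \<lfloor>real (Suc n) * z\<rfloor> + 1) / real (Suc n)" for n and z :: real
  have p: "z < p n z" "p n z \<le> z + 1 / real (Suc n)" for n z
  proof -
    have "real (Suc n) * z < of_int \<lfloor>real (Suc n) * z\<rfloor> + 1" by linarith
    then show "z < p n z" by (simp add: p_def field_simps)
    have "of_int \<lfloor>real (Suc n) * z\<rfloor> + 1 \<le> real (Suc n) * z + 1" by linarith
    then have "p n z \<le> (real (Suc n) * z + 1) / real (Suc n)"
      unfolding p_def by (intro divide_right_mono) auto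
    then show "p n z \<le> z + 1 / real (Suc n)" by (simp add: add_divide_distrib del: of_nat_Suc)
  qed
  fix z assume "z \<in> space mu"
  then have z: "0 < z" by simp
  have "(\<lambda>n. p n z) \<longlonglongrightarrow> z"
  proof (rule tendsto_sandwich[OF _ _ tendsto_const])
    show "(\<lambda>n. z + 1 / real (Suc n)) \<longlonglongrightarrow> z"
      using tendsto_add[OF tendsto_const LIMSEQ_inverse_real_of_nat, of z] by (simp add: inverse_eq_divide)
  qed (use p in \<open>auto intro!: always_eventually less_imp_le\<close>)
  then have "filterlim (\<lambda>n. p n z) (at_right z) sequentially"
    using p by (intro tendsto_imp_filterlim_at_right) auto
  then show "(\<lambda>n. f (p n z)) \<longlonglongrightarrow> f z"
    using assms[OF z] unfolding continuous_within by (rule filterlim_compose[rotated])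
next
  fix n
  have "(\<lambda>j. f ((of_int j + 1) / real (Suc n))) \<circ> (\<lambda>z. \<lfloor>real (Suc n) * z\<rfloor>) \<in> borel_measurable borel"
    by (rule measurable_comp[where N = "count_space UNIV"]) measurable
  then show "(\<lambda>z. f ((of_int \<lfloor>real (Suc n) * z\<rfloor> + 1) / real (Suc n))) \<in> borel_measurable mu"
    by (intro borel_measurable_mu) (simp add: o_def)
qed

section \<open>Compactness of \<open>K_R\<close>\<close>

text \<open>Local bounded variation without control of the constants; these intervals exhaust the
  open half line.\<close>

definition locally_dominated :: "(real \<Rightarrow> real) \<Rightarrow> bool" where
  "locally_dominated h \<longleftrightarrow> (\<forall>m. \<exists>W. variation_dominated h W (1 / real (Suc m)) (real (Suc m)))"

text \<open>h = W - (W - h) is a difference of nondecreasing functions, each of which has right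
  limits.\<close>

lemma locally_dominated_right_limit:
  assumes "locally_dominated h" "0 < x"
  shows "\<exists>l. (h \<longlongrightarrow> l) (at_right x)"
proof -
  obtain m where m: "1 / real (Suc m) < x" "x < real (Suc m)"
    using obtain_symmetric_interval[OF assms(2)] .
  let ?a = "1 / real (Suc m)" and ?b = "real (Suc m)"
  obtain W where W: "variation_dominated h W ?a ?b"
    using assms(1) unfolding locally_dominated_def by blast
  have I: "{x<..} \<inter> {?a<..<?b} = {x<..<?b}" using m by auto
  have at: "at x within {x<..<?b} = at_right x"
    by (rule at_within_nhd[of _ "{..<?b}"]) (use m in auto)
  have "(W \<longlongrightarrow> Inf (W ` ({x<..} \<inter> {?a<..<?b}))) (at x within ({x<..} \<inter> {?a<..<?b}))"
    by (rule Lim_right_bound[where K = "W x"]) (use m variation_dominated_mono(1)[OF W] in auto)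
  moreover have "((\<lambda>y. W y - h y) \<longlongrightarrow> Inf ((\<lambda>y. W y - h y) ` ({x<..} \<inter> {?a<..<?b})))
      (at x within ({x<..} \<inter> {?a<..<?b}))"
    by (rule Lim_right_bound[where K = "W x - h x"])
      (use m variation_dominated_mono(2)[OF W] in auto)
  ultimately have "((\<lambda>y. W y - (W y - h y)) \<longlongrightarrow>
      Inf (W ` ({x<..} \<inter> {?a<..<?b})) - Inf ((\<lambda>y. W y - h y) ` ({x<..} \<inter> {?a<..<?b}))) (at_right x)"
    unfolding I at by (rule tendsto_diff)
  then show ?thesis by auto
qed

lemma locally_dominated_countable_discontinuities:
  assumes "locally_dominated h"
  shows "countable {x. 0 < x \<and> \<not> isCont h x}"
proof -
  have "countable {x. 1 / real (Suc m) < x \<and> x < real (Suc m) \<and> \<not> isCont h x}" for m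
  proof -
    let ?I = "{1 / real (Suc m)<..<real (Suc m)}"
    obtain W where W: "variation_dominated h W (1 / real (Suc m)) (real (Suc m))"
      using assms unfolding locally_dominated_def by blast
    have "mono_on ?I W" "mono_on ?I (\<lambda>x. W x - h x)"
      using variation_dominated_mono[OF W] by (auto intro!: mono_onI)
    then have "countable ({x \<in> ?I. \<not> isCont W x} \<union> {x \<in> ?I. \<not> isCont (\<lambda>x. W x - h x) x})"
      by (intro countable_Un mono_on_ctble_discont_open open_greaterThanLessThan)
    moreover have "isCont h x" if "isCont W x" "isCont (\<lambda>x. W x - h x) x" for x
      using isCont_diff[OF that] by simp
    ultimately show ?thesis by (elim countable_subset[rotated]) auto
  qed
  moreover have "{x. 0 < x \<and> \<not> isCont h x} \<subseteq>
      (\<Union>m. {x. 1 / real (Suc m) < x \<and> x < real (Suc m) \<and> \<not> isCont h x})"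
    using obtain_symmetric_interval by blast
  ultimately show ?thesis by (meson countable_UN countable_subset countableI_type)
qed

text \<open>\<open>f\<close> consists of the right limits of \<open>h\<close>, so on the half line
  it differs from \<open>h\<close> at most at discontinuities of \<open>h\<close>. Its variation on
  [a, b] is estimated by that of \<open>h\<close> on a longer interval, which yields finiteness but
  not the bound R.\<close>

lemma right_regularization:
  assumes "locally_dominated h"
  obtains f where "f \<in> extensional {0<..}" "\<And>x. 0 < x \<Longrightarrow> continuous (at_right x) f"
    "f \<in> locally_bv" "AE x in mu. f x = h x"
proof -
  define f where "f = (\<lambda>x\<in>{0<..}. Lim (at_right x) h)"
  have lim: "(h \<longlongrightarrow> f x) (at_right x)" if "0 < x" for x
    using locally_dominated_right_limit[OF assms that] that
    by (auto simp: f_def tendsto_Lim[OF trivial_limit_at_right_real])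
  have "continuous (at_right x) f" if x: "0 < x" for x
    unfolding continuous_within
  proof (rule tendstoI)
    fix e :: real assume e: "0 < e"
    have "eventually (\<lambda>y. dist (h y) (f x) < e / 2) (at_right x)"
      using e by (intro tendstoD[OF lim[OF x]]) simp
    then obtain b where b: "x < b" "\<And>y. x < y \<Longrightarrow> y < b \<Longrightarrow> dist (h y) (f x) < e / 2"
      unfolding eventually_at_right_field by blast
    have "dist (f y) (f x) < e" if y: "x < y" "y < b" for y
    proof -
      have "eventually (\<lambda>z. dist (h z) (f x) \<le> e / 2) (at_right y)"
        unfolding eventually_at_right_field using b(2) y less_imp_le less_trans by blast
      then have "dist (f y) (f x) \<le> e / 2"
        using lim[of y] x y by (intro tendsto_upperbound[OF tendsto_dist[OF _ tendsto_const]]) auto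
      then show ?thesis using e by simp
    qed
    then show "eventually (\<lambda>y. dist (f y) (f x) < e) (at_right x)"
      unfolding eventually_at_right_field using b(1) by blast
  qed
  moreover have "f \<in> locally_bv"
    unfolding locally_bv_def
  proof (clarify)
    fix a b :: real assume ab: "0 < a" "a < b"
    \<comment> \<open>The second entry of the minimum gives b + 1 < m + 1, room for shifting a
      partition of [a, b] to the right by any t < 1.\<close>
    obtain m where m: "1 / real (Suc m) < min a (1 / (b + 1))"
      using obtain_symmetric_interval[of "min a (1 / (b + 1))"] ab by auto
    then have m': "1 / real (Suc m) < a" "b + 1 < real (Suc m)" using ab by (auto simp: field_simps)
    obtain W where W: "variation_dominated h W (1 / real (Suc m)) (real (Suc m))"
      using assms unfolding locally_dominated_def by blast
    let ?C = "W (real (Suc m)) - W (1 / real (Suc m))"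
    have "total_variation a b f \<le> ennreal ?C"
    proof (rule total_variation_leI)
      fix k and x :: "nat \<Rightarrow> real" assume x: "x 0 = a" "x k = b" "\<And>i. i < k \<Longrightarrow> x i < x (Suc i)"
      have pos: "0 < x i" if "i \<le> k" for i
        using partition_le[of k x 0 i] x that ab by auto
      have shift: "((\<lambda>t. h (x i + t)) \<longlongrightarrow> f (x i)) (at_right 0)" if "i \<le> k" for i
        using lim[OF pos[OF that]] by (subst (asm) filterlim_at_right_to_0) (simp add: add.commute)
      have "((\<lambda>t. \<Sum>i<k. \<bar>h (x (Suc i) + t) - h (x i + t)\<bar>) \<longlongrightarrow> (\<Sum>i<k. \<bar>f (x (Suc i)) - f (x i)\<bar>)) (at_right 0)"
        by (intro tendsto_sum tendsto_rabs tendsto_diff shift) auto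
      moreover have "(\<Sum>i<k. \<bar>h (x (Suc i) + t) - h (x i + t)\<bar>) \<le> ?C" if "0 < t" "t < 1" for t
      proof -
        have "(\<Sum>i<k. \<bar>h (x (Suc i) + t) - h (x i + t)\<bar>) \<le> W (x k + t) - W (x 0 + t)"
          by (rule variation_dominated_sum[OF W, of "\<lambda>i. x i + t"]) (use x m' that in auto)
        also have "\<dots> \<le> ?C"
          using variation_dominated_mono(1)[OF W, of "1 / real (Suc m)" "x 0 + t"]
            variation_dominated_mono(1)[OF W, of "x k + t" "real (Suc m)"] x m' that ab by auto
        finally show ?thesis .
      qed
      then have "eventually (\<lambda>t. (\<Sum>i<k. \<bar>h (x (Suc i) + t) - h (x i + t)\<bar>) \<le> ?C) (at_right 0)"
        unfolding eventually_at_right_field using zero_less_one by blast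
      ultimately have "(\<Sum>i<k. \<bar>f (x (Suc i)) - f (x i)\<bar>) \<le> ?C"
        by (intro tendsto_upperbound) auto
      then show "(\<Sum>i<k. ennreal \<bar>f (x (Suc i)) - f (x i)\<bar>) \<le> ennreal ?C"
        by (simp add: sum_ennreal ennreal_leI)
    qed
    then show "total_variation a b f < \<infinity>"
      by (rule le_less_trans) simp
  qed
  moreover have "AE x in mu. f x = h x"
  proof -
    have "f x = h x" if "0 < x" "isCont h x" for x
    proof (rule tendsto_unique[OF _ lim[OF that(1)]])
      show "(h \<longlongrightarrow> h x) (at_right x)"
        using that(2) unfolding continuous_at by (rule filterlim_mono) (auto simp: at_le)
    qed simp
    moreover have "AE x in lborel. x \<notin> {x. 0 < x \<and> \<not> isCont h x}"
      using locally_dominated_countable_discontinuities[OF assms]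
      by (intro AE_not_in countable_imp_null_set_lborel)
    ultimately show ?thesis unfolding AE_mu_iff by (elim eventually_mono) blast
  qed
  moreover have "f \<in> extensional {0<..}" by (simp add: f_def)
  ultimately show ?thesis using that by blast
qed

lemma K_R_iff:
  "f \<in> K_R kR R \<longleftrightarrow> f \<in> K_all \<and>
     (\<exists>g. (AE z in mu. f z = g z) \<and> (\<forall>z>0. g z \<le> kR R z) \<and> variation_bounds R g)"
  by (simp only: K_R_def variation_bounds_def mem_Collect_eq)

lemma variation_bounds_locally_dominated:
  "variation_bounds R h \<Longrightarrow> locally_dominated h"
  unfolding locally_dominated_def by (meson variation_bounds_imp_dominated)

lemma K_R_seq_compact:
  assumes int: "integrable mu (kR R)" and F: "\<And>n. F n \<in> K_R kR R"
  obtains r f where "strict_mono (r :: nat \<Rightarrow> nat)" "f \<in> K_R kR R"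
    "(\<lambda>n. mu_abs (\<lambda>z. F (r n) z - f z)) \<longlonglongrightarrow> 0"
proof -
  have "\<forall>n. \<exists>g. (AE z in mu. F n z = g z) \<and> (\<forall>z>0. g z \<le> kR R z) \<and> variation_bounds R g"
    using F by (simp add: K_R_iff)
  then obtain g where g: "\<And>n. AE z in mu. F n z = g n z" "\<And>n z. 0 < z \<Longrightarrow> g n z \<le> kR R z"
    "\<And>n. variation_bounds R (g n)" by metis
  have F': "integrable mu (F n)" "\<And>z. 0 < z \<Longrightarrow> 0 \<le> F n z" for n
    using F[of n] by (auto simp: K_R_iff K_all_def L_mu_def)
  \<comment> \<open>The versions are nonnegative only almost everywhere. At some y to the right of x
    the version \<open>g n\<close> agrees with \<open>F n\<close>, hence is nonnegative, and the
    variation between x and y costs at most 2 m R.\<close>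
  have bound: "\<exists>C. \<forall>n. \<bar>g n x\<bar> \<le> C" if x: "0 < x" for x
  proof -
    obtain m where m: "1 / real (Suc m) < x" "x < real (Suc m)"
      using obtain_symmetric_interval[OF x] .
    have "- (2 * real m * real R) \<le> g n x" for n
    proof -
      obtain W where W: "variation_dominated (g n) W (1 / real (Suc m)) (real (Suc m))"
        "W (1 / real (Suc m)) = 0" "W (real (Suc m)) \<le> 2 * real m * real R"
        using variation_bounds_imp_dominated[OF g(3)] by blast
      obtain y where y: "x < y" "y < real (Suc m)" "F n y = g n y"
        using AE_mu_point[OF g(1) x m(2)] .
      have "\<bar>g n y - g n x\<bar> \<le> W y - W x"
        using y m by (intro variation_dominatedD[OF W(1)]) auto
      moreover have "0 \<le> W x" "W y \<le> 2 * real m * real R"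
        using variation_dominated_mono(1)[OF W(1), of "1 / real (Suc m)" x]
          variation_dominated_mono(1)[OF W(1), of y "real (Suc m)"] W(2,3) y m by auto
      moreover have "0 \<le> g n y" using F'(2)[of y n] x y by simp
      ultimately show ?thesis by linarith
    qed
    then have "\<bar>g n x\<bar> \<le> max (2 * real m * real R) (kR R x)" for n
      using g(2)[OF x, of n] by (smt (verit))
    then show ?thesis by blast
  qed
  then obtain C where C: "\<And>n x. 0 < x \<Longrightarrow> \<bar>g n x\<bar> \<le> C x" by metis
  have "\<exists>r :: nat \<Rightarrow> nat. strict_mono r \<and> (\<forall>x>0. convergent (\<lambda>n. g (r n) x))"
    by (rule helly_pointwise[where g = g, OF g(3) C]) auto
  then obtain r where r: "strict_mono (r :: nat \<Rightarrow> nat)" "\<And>x. 0 < x \<Longrightarrow> convergent (\<lambda>n. g (r n) x)"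
    by blast
  define h where "h x = lim (\<lambda>n. g (r n) x)" for x
  have h: "(\<lambda>n. g (r n) x) \<longlonglongrightarrow> h x" if "0 < x" for x
    using r(2)[OF that] by (simp add: h_def convergent_LIMSEQ_iff)
  have h_bounds: "variation_bounds R h"
    by (rule variation_bounds_limit[OF h g(3)])
  have h_le: "h x \<le> kR R x" if "0 < x" for x
    using LIMSEQ_le_const2[OF h[OF that]] g(2)[OF that] by blast
  obtain f where f: "f \<in> extensional {0<..}" "\<And>x. 0 < x \<Longrightarrow> continuous (at_right x) f"
    "f \<in> locally_bv" "AE x in mu. f x = h x"
    using right_regularization[OF variation_bounds_locally_dominated[OF h_bounds]] by blast
  have "AE z in mu. \<forall>n. F n z = g n z" using g(1) by (simp add: AE_all_countable)
  with f(4) have ae: "AE z in mu. 0 \<le> f z \<and> f z \<le> kR R z \<and>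
      (\<forall>n. F n z \<le> kR R z \<and> 0 \<le> F n z) \<and> (\<lambda>n. F (r n) z) \<longlonglongrightarrow> f z"
    using AE_space
  proof eventually_elim
    case (elim z)
    then have z: "0 < z" by simp
    have lim: "(\<lambda>n. F (r n) z) \<longlonglongrightarrow> f z" using h[OF z] elim by simp
    moreover have "0 \<le> f z" using LIMSEQ_le_const[OF lim] F'(2)[OF z] by blast
    ultimately show ?case using elim h_le[OF z] g(2)[OF z] F'(2)[OF z] by simp
  qed
  have "f \<in> borel_measurable mu" by (rule right_continuous_measurable_mu) (rule f)
  then have f_int: "integrable mu f"
    by (rule Bochner_Integration.integrable_bound[OF int]) (rule eventually_mono[OF ae], auto)
  have "0 \<le> f z" if "0 < z" for z
  proof -
    have "AE z in mu. f z \<in> {0..}" by (rule eventually_mono[OF ae]) auto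
    then show ?thesis using AE_mu_right_continuous[of f "{0..}" z] that f(2)[OF that] by auto
  qed
  then have "f \<in> K_all" using f f_int by (simp add: K_all_def L_mu_def)
  then have "f \<in> K_R kR R" using f(4) h_le h_bounds unfolding K_R_iff by blast
  moreover have "(\<lambda>n. LINT z|mu. \<bar>F (r n) z - f z\<bar>) \<longlonglongrightarrow> (LINT z|mu. 0)"
  proof (rule integral_dominated_convergence)
    show "integrable mu (\<lambda>z. 2 * kR R z)" using int by simp
    show "AE z in mu. (\<lambda>n. \<bar>F (r n) z - f z\<bar>) \<longlonglongrightarrow> 0"
      using ae by eventually_elim (auto intro!: tendsto_rabs_zero LIM_zero)
    show "AE z in mu. norm \<bar>F (r n) z - f z\<bar> \<le> 2 * kR R z" for n
      using ae
    proof eventually_elim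
      case (elim z)
      then have "F (r n) z \<le> kR R z" "0 \<le> F (r n) z" "0 \<le> f z" "f z \<le> kR R z" by blast+
      then show ?case by (simp add: abs_le_iff)
    qed
  qed (use F' f_int in auto)
  then have "(\<lambda>n. mu_abs (\<lambda>z. F (r n) z - f z)) \<longlonglongrightarrow> 0" by (simp add: mu_abs_def)
  ultimately show ?thesis using that r(1) by blast
qed

section \<open>The exponent of a Levy density\<close>

lemma
  fixes f :: "real \<Rightarrow> 'b::{banach, second_countable_topology}"
  assumes [measurable]: "f \<in> borel_measurable mu"
  shows integrable_mu_iff: "integrable mu f \<longleftrightarrow> set_integrable lborel {0<..} (\<lambda>z. min 1 z *\<^sub>R f z)"
    and integral_mu: "(LINT z|mu. f z) = (LINT z:{0<..}|lborel. min 1 z *\<^sub>R f z)"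
proof -
  let ?N = "restrict_space lborel {0<..} :: real measure"
  have [measurable]: "(\<lambda>z::real. min 1 z) \<in> borel_measurable ?N"
    by (rule measurable_restrict_space1) measurable
  have f: "f \<in> borel_measurable ?N"
    using assms by (subst (asm) measurable_cong_sets[OF sets_mu refl])
      (simp cong: measurable_cong_sets sets_restrict_space_cong)
  have ae: "AE z in ?N. 0 \<le> min 1 z"
    by (subst AE_restrict_space_iff) auto
  show "integrable mu f \<longleftrightarrow> set_integrable lborel {0<..} (\<lambda>z. min 1 z *\<^sub>R f z)"
    unfolding mu_def by (subst integrable_density[OF f _ ae])
      (simp_all add: integrable_restrict_space set_integrable_def)
  show "(LINT z|mu. f z) = (LINT z:{0<..}|lborel. min 1 z *\<^sub>R f z)"
    unfolding mu_def by (subst integral_density[OF f _ ae])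
      (simp_all add: integral_restrict_space set_lebesgue_integral_def)
qed

text \<open>Mean value inequality on the convex half plane Re w >= \<rho>, where the derivative has
  norm at most z e^(-z \<rho>).\<close>

lemma norm_exp_diff_le:
  fixes u v :: complex
  assumes "0 \<le> z" "\<rho> \<le> Re u" "\<rho> \<le> Re v"
  shows "norm (exp (- (of_real z * u)) - exp (- (of_real z * v))) \<le> z * exp (- (z * \<rho>)) * norm (u - v)"
proof (rule field_differentiable_bound[of "{w. \<rho> \<le> Re w}" _ "\<lambda>w. - of_real z * exp (- (of_real z * w))"])
  show "convex {w. \<rho> \<le> Re w}" by (rule convex_halfspace_Re_ge)
  show "((\<lambda>w. exp (- (of_real z * w))) has_field_derivative - of_real z * exp (- (of_real z * w)))
      (at w within {w. \<rho> \<le> Re w})" for w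
    by (auto intro!: derivative_eq_intros)
  show "norm (- of_real z * exp (- (of_real z * w))) \<le> z * exp (- (z * \<rho>))" if "w \<in> {w. \<rho> \<le> Re w}" for w
    using that assms(1) by (auto simp: norm_mult intro!: mult_left_mono)
qed (use assms in auto)

lemma norm_one_minus_exp_le:
  fixes u :: complex
  assumes "0 \<le> z" "0 \<le> Re u"
  shows "norm (1 - exp (- (of_real z * u))) \<le> z * norm u" "norm (1 - exp (- (of_real z * u))) \<le> 2"
proof -
  show "norm (1 - exp (- (of_real z * u))) \<le> z * norm u"
    using norm_exp_diff_le[of z 0 0 u] assms by simp
  have "norm (exp (- (of_real z * u))) \<le> 1" using assms by simp
  moreover have "norm (1 - exp (- (of_real z * u))) \<le> 1 + norm (exp (- (of_real z * u)))"
    using norm_triangle_ineq4[of 1 "exp (- (of_real z * u))"] by simp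
  ultimately show "norm (1 - exp (- (of_real z * u))) \<le> 2" by linarith
qed

lemma mult_exp_minus_le:
  assumes "0 < \<rho>"
  shows "(z::real) * exp (- (z * \<rho>)) \<le> 1 / \<rho>"
proof -
  have "z * \<rho> \<le> exp (z * \<rho>)" using exp_ge_add_one_self[of "z * \<rho>"] by linarith
  then show ?thesis using assms by (simp add: exp_minus field_simps)
qed

text \<open>The function \<phi> of the overview, written against \<open>mu\<close>: division by
  \<open>min 1 z\<close> undoes its density, so that integrability of \<open>h\<close> under
  \<open>mu\<close> suffices for Re u >= 0.\<close>

definition levy_exponent :: "(real \<Rightarrow> real) \<Rightarrow> complex \<Rightarrow> complex" where
  "levy_exponent h u = (LINT z|mu. of_real (h z / min 1 z) * (1 - exp (- (of_real z * u))))"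

text \<open>On the half line the second integrand is the u-derivative of the first, because z /
  \<open>min 1 z\<close> = \<open>max 1 z\<close>.\<close>

lemma measurable_levy_integrand:
  assumes "h \<in> borel_measurable mu"
  shows "(\<lambda>z. of_real (h z / min 1 z) * (1 - exp (- (of_real z * u)))) \<in> borel_measurable mu"
    and "(\<lambda>z. of_real (h z * max 1 z) * exp (- (of_real z * u :: complex))) \<in> borel_measurable mu"
proof -
  note assms[measurable]
  have [measurable]: "(\<lambda>z::real. min 1 z) \<in> borel_measurable mu" "(\<lambda>z::real. max 1 z) \<in> borel_measurable mu"
    by (intro borel_measurable_mu; measurable)+
  have [measurable]: "(\<lambda>z. exp (- (of_real z * u))) \<in> borel_measurable mu"
    by (intro borel_measurable_mu borel_measurable_continuous_onI continuous_intros)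
  show "(\<lambda>z. of_real (h z / min 1 z) * (1 - exp (- (of_real z * u)))) \<in> borel_measurable mu"
    "(\<lambda>z. of_real (h z * max 1 z) * exp (- (of_real z * u :: complex))) \<in> borel_measurable mu"
    by measurable
qed

text \<open>The kernel is at most |u| z for small z and at most 2 for large z, hence at most max 2
  |u| times \<open>min 1 z\<close>, which cancels the divisor.\<close>

lemma norm_levy_integrand_le:
  assumes "0 < z" "0 \<le> Re u"
  shows "norm (of_real (h z / min 1 z) * (1 - exp (- (of_real z * u)))) \<le> max 2 (norm u) * \<bar>h z\<bar>"
proof -
  have "norm (1 - exp (- (of_real z * u))) \<le> max 2 (norm u) * min 1 z"
    using norm_one_minus_exp_le[of z u] assms
    by (cases "z \<le> 1") (auto simp: min_def max_def mult.commute intro: order_trans mult_mono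
       elim!: order_trans)
  then have "\<bar>h z\<bar> / min 1 z * norm (1 - exp (- (of_real z * u))) \<le> \<bar>h z\<bar> / min 1 z * (max 2 (norm u) * min 1 z)"
    using assms by (intro mult_left_mono) auto
  also have "\<dots> = max 2 (norm u) * \<bar>h z\<bar>"
    using assms by (simp add: min_def)
  finally show ?thesis using assms by (simp add: norm_mult norm_divide)
qed

lemma integrable_levy_integrand:
  assumes "integrable mu h" "0 \<le> Re u"
  shows "integrable mu (\<lambda>z. of_real (h z / min 1 z) * (1 - exp (- (of_real z * u))))"
proof (rule Bochner_Integration.integrable_bound)
  show "integrable mu (\<lambda>z. max 2 (norm u) * \<bar>h z\<bar>)" using assms by simp
  show "AE z in mu. norm (of_real (h z / min 1 z) * (1 - exp (- (of_real z * u)))) \<le> norm (max 2 (norm u) * \<bar>h z\<bar>)"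
    using norm_levy_integrand_le[OF _ assms(2)] by (intro AE_I2) (auto simp: abs_mult)
qed (use assms in \<open>intro measurable_levy_integrand(1), auto\<close>)

text \<open>Differentiation under the integral sign, along sequences for the sake of dominated
  convergence. Re u > 0 supplies the exponential factor that tames z at infinity.\<close>

lemma levy_exponent_has_field_derivative:
  assumes h: "integrable mu h" and u: "0 < Re u"
  shows "(levy_exponent h has_field_derivative (LINT z|mu. of_real (h z * max 1 z) * exp (- (of_real z * u)))) (at u)"
  unfolding has_field_derivative_iff tendsto_at_iff_sequentially comp_def
proof (intro allI impI)
  fix X assume X: "\<forall>i. X i \<in> UNIV - {u}" "X \<longlonglongrightarrow> u"
  \<comment> \<open>Any value strictly between 0 and Re u would do. The finitely many terms that may
    fall outside Re w > \<rho> are skipped by the offset N and restored by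
    \<open>LIMSEQ_offset\<close>.\<close>
  define \<rho> where "\<rho> = Re u / 2"
  have \<rho>: "0 < \<rho>" "\<rho> < Re u" using u by (auto simp: \<rho>_def)
  have "eventually (\<lambda>n. \<rho> < Re (X n)) sequentially"
    using tendsto_Re[OF X(2)] \<rho>(2) by (rule order_tendstoD(1))
  then obtain N where N: "\<And>n. N \<le> n \<Longrightarrow> \<rho> < Re (X n)" unfolding eventually_sequentially by blast
  define s where "s n z = of_real (h z / min 1 z) * (1 - exp (- (of_real z * X n)))" for n z
  define s0 where "s0 z = of_real (h z / min 1 z) * (1 - exp (- (of_real z * u)))" for z
  have meas: "s n \<in> borel_measurable mu" "s0 \<in> borel_measurable mu" for n
    unfolding s_def s0_def by (rule measurable_levy_integrand(1)[OF borel_measurable_integrable[OF h]])+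
  have "(\<lambda>n. LINT z|mu. (s (n + N) z - s0 z) / (X (n + N) - u))
      \<longlonglongrightarrow> (LINT z|mu. of_real (h z * max 1 z) * exp (- (of_real z * u)))"
  proof (rule integral_dominated_convergence)
    show "(\<lambda>z. of_real (h z * max 1 z) * exp (- (of_real z * u))) \<in> borel_measurable mu"
      using h by (intro measurable_levy_integrand(2)) auto
    show "(\<lambda>z. (s (n + N) z - s0 z) / (X (n + N) - u)) \<in> borel_measurable mu" for n
      using meas by (intro borel_measurable_divide borel_measurable_diff) auto
    \<comment> \<open>The constant bounds z / \<open>min 1 z\<close> * e^(-z \<rho>), the maximum of
      e^(-z \<rho>) <= 1 and z e^(-z \<rho>) <= 1 / \<rho>.\<close>
    show "integrable mu (\<lambda>z. (1 + 1 / \<rho>) * \<bar>h z\<bar>)" using h by simp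
    show "AE z in mu. (\<lambda>n. (s (n + N) z - s0 z) / (X (n + N) - u))
      \<longlonglongrightarrow> of_real (h z * max 1 z) * exp (- (of_real z * u))"
    proof (rule AE_I2)
      fix z assume "z \<in> space mu"
      then have z: "0 < z" by simp
      have "((\<lambda>w. of_real (h z / min 1 z) * (1 - exp (- (of_real z * w)))) has_field_derivative
          of_real (h z / min 1 z) * (of_real z * exp (- (of_real z * u)))) (at u)"
        using z by (auto intro!: derivative_eq_intros simp: min_def)
      moreover have "h z / min 1 z * z = h z * max 1 z" using z by (auto simp: min_def max_def)
      then have "of_real (h z / min 1 z) * (of_real z * exp (- (of_real z * u))) = of_real (h z * max 1 z) * exp (- (of_real z * u))"
        by (metis mult.assoc of_real_mult)
      ultimately have "(\<lambda>n. (s n z - s0 z) / (X n - u)) \<longlonglongrightarrow> of_real (h z * max 1 z) * exp (- (of_real z * u))"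
        using X unfolding has_field_derivative_iff tendsto_at_iff_sequentially comp_def s_def s0_def by auto
      then show "(\<lambda>n. (s (n + N) z - s0 z) / (X (n + N) - u))
        \<longlonglongrightarrow> of_real (h z * max 1 z) * exp (- (of_real z * u))"
        by (rule LIMSEQ_ignore_initial_segment)
    qed
    show "AE z in mu. norm ((s (n + N) z - s0 z) / (X (n + N) - u)) \<le> (1 + 1 / \<rho>) * \<bar>h z\<bar>" for n
    proof (rule AE_I2)
      fix z assume "z \<in> space mu"
      then have z: "0 < z" by simp
      let ?w = "X (n + N)"
      have mz: "0 < min 1 z" using z by simp
      have w: "\<rho> \<le> Re ?w" "?w \<noteq> u" using N[of "n + N"] X(1) by auto
      have "norm (s (n + N) z - s0 z) = \<bar>h z\<bar> / min 1 z * norm (exp (- (of_real z * u)) - exp (- (of_real z * ?w)))"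
        unfolding s_def s0_def right_diff_distrib[symmetric] using mz by (simp add: norm_mult norm_divide)
      also have "\<dots> \<le> \<bar>h z\<bar> / min 1 z * (z * exp (- (z * \<rho>)) * norm (u - ?w))"
        using z mz w \<rho> by (intro mult_left_mono norm_exp_diff_le) auto
      also have "\<dots> = \<bar>h z\<bar> * (z / min 1 z * exp (- (z * \<rho>))) * norm (?w - u)"
        by (simp add: norm_minus_commute)
      also have "\<dots> \<le> \<bar>h z\<bar> * (1 + 1 / \<rho>) * norm (?w - u)"
      proof (intro mult_right_mono mult_left_mono)
        have "z / min 1 z * exp (- (z * \<rho>)) = max (exp (- (z * \<rho>))) (z * exp (- (z * \<rho>)))"
          using z by (auto simp: min_def max_def)
        moreover have "exp (- (z * \<rho>)) \<le> 1" using z \<rho> by simp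
        ultimately show "z / min 1 z * exp (- (z * \<rho>)) \<le> 1 + 1 / \<rho>"
          using mult_exp_minus_le[OF \<rho>(1), of z] \<rho> by (simp add: add_increasing add_increasing2)
      qed auto
      finally show "norm ((s (n + N) z - s0 z) / (?w - u)) \<le> (1 + 1 / \<rho>) * \<bar>h z\<bar>"
        using w by (simp add: norm_divide divide_le_eq mult.commute)
    qed
  qed
  moreover have "(LINT z|mu. (s (n + N) z - s0 z) / (X (n + N) - u)) =
      (levy_exponent h (X (n + N)) - levy_exponent h u) / (X (n + N) - u)" for n
  proof -
    have "integrable mu (s (n + N))" "integrable mu s0"
      unfolding s_def s0_def using N[of "n + N"] \<rho> u by (intro integrable_levy_integrand[OF h]; simp)+
    then show ?thesis
      unfolding levy_exponent_def s_def[symmetric] s0_def[symmetric]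
      by (simp add: Bochner_Integration.integral_diff)
  qed
  ultimately have "(\<lambda>n. (levy_exponent h (X (n + N)) - levy_exponent h u) / (X (n + N) - u))
      \<longlonglongrightarrow> (LINT z|mu. of_real (h z * max 1 z) * exp (- (of_real z * u)))"
    by (simp only:)
  then show "(\<lambda>n. (levy_exponent h (X n) - levy_exponent h u) / (X n - u))
      \<longlonglongrightarrow> (LINT z|mu. of_real (h z * max 1 z) * exp (- (of_real z * u)))"
    by (rule LIMSEQ_offset)
qed

text \<open>The point 0 lies on the boundary of the half plane of holomorphy, so the limit there
  needs its own dominated convergence.\<close>

lemma levy_exponent_tendsto_0:
  assumes h: "integrable mu h" and X: "X \<longlonglongrightarrow> 0" "\<And>n. 0 \<le> Re (X n)"
  shows "(\<lambda>n. levy_exponent h (X n)) \<longlonglongrightarrow> 0"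
proof -
  obtain C where C: "\<And>n. norm (X n) \<le> C"
    using convergent_imp_Bseq[of X] X(1) unfolding Bseq_def convergent_def by blast
  have "(\<lambda>n. LINT z|mu. of_real (h z / min 1 z) * (1 - exp (- (of_real z * X n)))) \<longlonglongrightarrow> (LINT z|mu. (0::complex))"
  proof (rule integral_dominated_convergence)
    show "(\<lambda>z. of_real (h z / min 1 z) * (1 - exp (- (of_real z * X n)))) \<in> borel_measurable mu" for n
      using h by (intro measurable_levy_integrand(1)) auto
    show "integrable mu (\<lambda>z. max 2 C * \<bar>h z\<bar>)" using h by simp
    show "AE z in mu. norm (of_real (h z / min 1 z) * (1 - exp (- (of_real z * X n)))) \<le> max 2 C * \<bar>h z\<bar>" for n
    proof (rule AE_I2)
      fix z assume "z \<in> space mu"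
      then have z: "0 < z" by simp
      show "norm (of_real (h z / min 1 z) * (1 - exp (- (of_real z * X n)))) \<le> max 2 C * \<bar>h z\<bar>"
        by (rule order_trans[OF norm_levy_integrand_le[OF z X(2)]])
          (use C[of n] in \<open>auto intro!: mult_right_mono max.mono\<close>)
    qed
    show "AE z in mu. (\<lambda>n. of_real (h z / min 1 z) * (1 - exp (- (of_real z * X n)))) \<longlonglongrightarrow> 0"
    proof (rule AE_I2)
      fix z
      have "(\<lambda>n. of_real (h z / min 1 z) * (1 - exp (- (of_real z * X n))))
          \<longlonglongrightarrow> of_real (h z / min 1 z) * (1 - exp (- (of_real z * 0)))"
        by (intro tendsto_intros X)
      then show "(\<lambda>n. of_real (h z / min 1 z) * (1 - exp (- (of_real z * X n)))) \<longlonglongrightarrow> 0" by simp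
    qed
  qed simp
  then show ?thesis by (simp add: levy_exponent_def)
qed

section \<open>Recovering a density from its Levy exponent\<close>

lemma density_unique_Fourier:
  fixes \<rho>\<^sub>1 \<rho>\<^sub>2 :: "real \<Rightarrow> real"
  assumes int: "integrable lborel \<rho>\<^sub>1" "integrable lborel \<rho>\<^sub>2"
    and nonneg: "\<And>x. 0 \<le> \<rho>\<^sub>1 x" "\<And>x. 0 \<le> \<rho>\<^sub>2 x"
    and eq: "\<And>t. (LINT x|lborel. of_real (\<rho>\<^sub>1 x) * iexp (t * x)) = (LINT x|lborel. of_real (\<rho>\<^sub>2 x) * iexp (t * x))"
  shows "AE x in lborel. \<rho>\<^sub>1 x = \<rho>\<^sub>2 x"
proof -
  \<comment> \<open>At t = 0 the transforms are the total masses. If the common mass m is 0, both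
    densities vanish; otherwise division by m gives probability densities, and Levy's uniqueness
    theorem for characteristic functions applies.\<close>
  define m where "m = (LINT x|lborel. \<rho>\<^sub>1 x)"
  have "complex_of_real (LINT x|lborel. \<rho>\<^sub>1 x) = complex_of_real (LINT x|lborel. \<rho>\<^sub>2 x)"
    using eq[of 0] by (simp flip: integral_complex_of_real)
  then have m: "(LINT x|lborel. \<rho>\<^sub>1 x) = m" "(LINT x|lborel. \<rho>\<^sub>2 x) = m"
    unfolding of_real_eq_iff by (auto simp: m_def)
  have "0 \<le> m" unfolding m_def using nonneg by simp
  show ?thesis
  proof (cases "m = 0")
    case True
    have "AE x in lborel. \<rho>\<^sub>1 x = 0" "AE x in lborel. \<rho>\<^sub>2 x = 0"
      using m True int nonneg by (simp_all add: integral_nonneg_eq_0_iff_AE)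
    then show ?thesis by eventually_elim simp
  next
    case False
    with \<open>0 \<le> m\<close> have m_pos: "0 < m" by simp
    have dist: "real_distribution (density lborel (\<lambda>x. ennreal (\<rho> x / m)))"
      and ch: "char (density lborel (\<lambda>x. ennreal (\<rho> x / m))) t = (LINT x|lborel. of_real (\<rho> x) * iexp (t * x)) / m"
      if \<rho>: "integrable lborel \<rho>" "\<And>x. 0 \<le> \<rho> x" "(LINT x|lborel. \<rho> x) = m" for \<rho> :: "real \<Rightarrow> real" and t
    proof -
      have [measurable]: "\<rho> \<in> borel_measurable lborel" using \<rho>(1) by simp
      have "(\<integral>\<^sup>+ x. ennreal (\<rho> x / m) \<partial>lborel) = ennreal (LINT x|lborel. \<rho> x / m)"
        using \<rho> m_pos by (intro nn_integral_eq_integral) auto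
      also have "\<dots> = 1" using \<rho>(3) m_pos by simp
      finally have "(\<integral>\<^sup>+ x. ennreal (\<rho> x / m) \<partial>lborel) = 1" .
      then have "prob_space (density lborel (\<lambda>x. ennreal (\<rho> x / m)))"
        by (intro prob_spaceI) (simp add: emeasure_density cong: nn_integral_cong)
      then show "real_distribution (density lborel (\<lambda>x. ennreal (\<rho> x / m)))"
        by (simp add: real_distribution_def real_distribution_axioms_def)
      have "char (density lborel (\<lambda>x. ennreal (\<rho> x / m))) t = (LINT x|lborel. (\<rho> x / m) *\<^sub>R iexp (t * x))"
        unfolding char_def using \<rho>(2) m_pos by (intro integral_density) auto
      also have "\<dots> = (LINT x|lborel. of_real (\<rho> x) * iexp (t * x) / m)"
        by (simp add: scaleR_conv_of_real)
      finally show "char (density lborel (\<lambda>x. ennreal (\<rho> x / m))) t = (LINT x|lborel. of_real (\<rho> x) * iexp (t * x)) / m"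
        by simp
    qed
    have "density lborel (\<lambda>x. ennreal (\<rho>\<^sub>1 x / m)) = density lborel (\<lambda>x. ennreal (\<rho>\<^sub>2 x / m))"
      by (intro Levy_uniqueness dist ext)
        (use int nonneg m eq in \<open>auto simp: ch[OF int(1) nonneg(1) m(1)] ch[OF int(2) nonneg(2) m(2)]\<close>)
    then have "AE x in lborel. ennreal (\<rho>\<^sub>1 x / m) = ennreal (\<rho>\<^sub>2 x / m)"
      by (intro sigma_finite_measure.density_unique[OF sigma_finite_lborel]) (use int in auto)
    then show ?thesis
      by eventually_elim (use nonneg m_pos in \<open>auto simp: ennreal_inj\<close>)
  qed
qed

text \<open>A vanishing exponent has vanishing derivative, and on the line Re u = 1 the derivatives
  for \<open>f\<close> and \<open>g\<close> are the Fourier transforms of z e^(-z) f z and z e^(-z)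
  g z. Keeping the two apart preserves the nonnegativity that the probabilistic uniqueness theorem
  demands.\<close>

lemma levy_exponent_unique:
  assumes int: "integrable mu f" "integrable mu g"
    and nonneg: "\<And>z. 0 < z \<Longrightarrow> 0 \<le> f z" "\<And>z. 0 < z \<Longrightarrow> 0 \<le> g z"
    and zero: "\<And>u. 0 < Re u \<Longrightarrow> levy_exponent (\<lambda>z. f z - g z) u = 0"
  shows "AE z in mu. f z = g z"
proof -
  \<comment> \<open>Lebesgue density of the derivative integrand at u = 1 - i t without its
    oscillating factor; the factor z arises as min 1 z * max 1 z.\<close>
  define \<rho> where "\<rho> k z = indicator {0<..} z * (k z * z * exp (- z))" for k :: "real \<Rightarrow> real" and z
  have \<rho>_int: "integrable lborel (\<rho> k)" 
    and \<rho>_fourier: "(LINT z|mu. of_real (k z * max 1 z) * exp (- (of_real z * Complex 1 (- t)))) =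
      (LINT x|lborel. of_real (\<rho> k x) * iexp (t * x))"
    and k_int: "integrable mu (\<lambda>z. of_real (k z * max 1 z) * exp (- (of_real z * Complex 1 (- t))))"
    if k: "integrable mu k" for k t
  proof -
    have [measurable]: "k \<in> borel_measurable mu" using k by simp
    have [measurable]: "(\<lambda>z::real. max 1 z) \<in> borel_measurable mu" "(\<lambda>z::real. exp (- z)) \<in> borel_measurable mu"
      by (intro borel_measurable_mu; measurable)+
    have bound: "max 1 z * exp (- z) \<le> 1" if "0 < z" for z :: real
      using mult_exp_minus_le[of 1 z] that by (auto simp: max_def)
    then have bound': "\<bar>k z\<bar> * (max 1 z * exp (- z)) \<le> \<bar>k z\<bar>" if "0 < z" for z
      using that by (intro mult_left_le) auto
    have "integrable mu (\<lambda>z. k z * max 1 z * exp (- z))"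
      by (rule Bochner_Integration.integrable_bound[OF k])
        (use bound' in \<open>auto intro!: AE_I2 simp: abs_mult mult.assoc\<close>)
    then have "set_integrable lborel {0<..} (\<lambda>z. min 1 z *\<^sub>R (k z * max 1 z * exp (- z)))"
      by (subst (asm) integrable_mu_iff) auto
    moreover have eq: "min 1 z * (k z * max 1 z * exp (- z)) = k z * z * exp (- z)" for z :: real
      by (auto simp: min_def max_def)
    ultimately show "integrable lborel (\<rho> k)"
      by (simp add: \<rho>_def[abs_def] set_integrable_def eq)
    show "integrable mu (\<lambda>z. of_real (k z * max 1 z) * exp (- (of_real z * Complex 1 (- t))))"
      by (rule Bochner_Integration.integrable_bound[OF k measurable_levy_integrand(2)])
        (use bound' in \<open>auto intro!: AE_I2 simp: norm_mult abs_mult mult.assoc simp flip: of_real_mult\<close>)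
    have exp_eq: "exp (- (of_real z * Complex 1 (- t))) = of_real (exp (- z)) * iexp (t * z)" for z
      by (simp add: exp_of_real[symmetric] exp_add[symmetric] complex_eq_iff Complex_eq algebra_simps del: exp_of_real)
    have "(LINT z|mu. of_real (k z * max 1 z) * exp (- (of_real z * Complex 1 (- t)))) =
      (LINT z:{0<..}|lborel. min 1 z *\<^sub>R (of_real (k z * max 1 z) * exp (- (of_real z * Complex 1 (- t)))))"
      by (rule integral_mu) (intro measurable_levy_integrand(2), measurable)
    also have "\<dots> = (LINT x|lborel. of_real (\<rho> k x) * iexp (t * x))"
      unfolding set_lebesgue_integral_def
    proof (intro Bochner_Integration.integral_cong refl)
      fix z :: real
      have "min 1 z *\<^sub>R (of_real (k z * max 1 z) * exp (- (of_real z * Complex 1 (- t)))) =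
        of_real (k z * z * exp (- z)) * iexp (t * z)"
        unfolding exp_eq scaleR_conv_of_real eq[symmetric] of_real_mult by (simp only: mult_ac)
      then show "indicator {0<..} z *\<^sub>R min 1 z *\<^sub>R (of_real (k z * max 1 z) * exp (- (of_real z * Complex 1 (- t)))) =
         of_real (\<rho> k z) * iexp (t * z)"
        unfolding \<rho>_def by (cases "z \<in> {0<..}") (simp_all only: indicator_simps not_False_eq_True scaleR_one scaleR_zero_left mult_1 mult_zero_left of_real_0)
    qed
    finally show "(LINT z|mu. of_real (k z * max 1 z) * exp (- (of_real z * Complex 1 (- t)))) =
      (LINT x|lborel. of_real (\<rho> k x) * iexp (t * x))" .
  qed
  have "AE x in lborel. \<rho> f x = \<rho> g x"
  proof (rule density_unique_Fourier)
    fix t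
    let ?u = "Complex 1 (- t)"
    have "(levy_exponent (\<lambda>z. f z - g z) has_field_derivative 0) (at ?u)"
    proof (rule has_field_derivative_transform_within_open[of "\<lambda>_. 0" _ _ "{u. 0 < Re u}"])
      show "open {u. 0 < Re u}" by (rule open_halfspace_Re_gt)
    qed (use zero in auto)
    moreover have "(levy_exponent (\<lambda>z. f z - g z) has_field_derivative
        (LINT z|mu. of_real ((f z - g z) * max 1 z) * exp (- (of_real z * ?u)))) (at ?u)"
      using int by (intro levy_exponent_has_field_derivative) auto
    ultimately have "(LINT z|mu. of_real ((f z - g z) * max 1 z) * exp (- (of_real z * ?u))) = 0"
      by (rule DERIV_unique[symmetric])
    moreover have "(LINT z|mu. of_real ((f z - g z) * max 1 z) * exp (- (of_real z * ?u))) =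
       (LINT z|mu. of_real (f z * max 1 z) * exp (- (of_real z * ?u))) -
       (LINT z|mu. of_real (g z * max 1 z) * exp (- (of_real z * ?u)))"
      by (subst Bochner_Integration.integral_diff[symmetric, OF k_int[OF int(1)] k_int[OF int(2)]])
        (simp only: of_real_mult of_real_diff left_diff_distrib)
    ultimately show "(LINT x|lborel. of_real (\<rho> f x) * iexp (t * x)) = (LINT x|lborel. of_real (\<rho> g x) * iexp (t * x))"
      unfolding \<rho>_fourier[OF int(1)] \<rho>_fourier[OF int(2)] by simp
  qed (use int nonneg in \<open>auto simp: \<rho>_int, auto simp: \<rho>_def indicator_def\<close>)
  then have "AE z in lborel. 0 < z \<longrightarrow> f z = g z"
    by eventually_elim (auto simp: \<rho>_def)
  then show ?thesis unfolding AE_mu_iff .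
qed

section \<open>Injectivity of \<open>T_op\<close>\<close>

lemma v_flow_nonneg:
  assumes "0 < b" "0 < c" "0 \<le> t" "0 \<le> l"
  shows "0 < b + c * l * (1 - exp (- b * t))" "0 \<le> v_flow b c t l" "v_flow b c t l \<le> l"
proof -
  have e: "0 < exp (- b * t)" "exp (- b * t) \<le> 1" using assms by auto
  then have "0 \<le> c * l * (1 - exp (- b * t))" using assms by auto
  then show pos: "0 < b + c * l * (1 - exp (- b * t))" using assms by linarith
  show "0 \<le> v_flow b c t l" using pos e assms unfolding v_flow_def by (intro divide_nonneg_pos) auto
  have "b * exp (- b * t) * l \<le> b * l" using e assms by (simp add: mult_left_le mult_right_mono)
  also have "\<dots> \<le> (b + c * l * (1 - exp (- b * t))) * l"
    using \<open>0 \<le> c * l * (1 - exp (- b * t))\<close> assms by (intro mult_right_mono) auto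
  finally show "v_flow b c t l \<le> l" unfolding v_flow_def using pos by (simp add: divide_le_eq mult.commute)
qed

lemma v_flow_pos:
  assumes "0 < b" "0 < c" "0 \<le> t" "0 < l"
  shows "0 < v_flow b c t l"
  using v_flow_nonneg(1)[of b c t l] assms unfolding v_flow_def by (intro divide_pos_pos) auto

lemma v_flow_0: "0 < b \<Longrightarrow> v_flow b c 0 l = l"
  by (simp add: v_flow_def)

lemma v_flow_deriv:
  assumes "0 < b" "0 < c" "0 \<le> t" "0 \<le> l"
  shows "((\<lambda>t. v_flow b c t l) has_real_derivative - (b * v_flow b c t l + c * (v_flow b c t l)\<^sup>2)) (at t within S)"
proof -
  let ?E = "exp (- b * t)" and ?D = "b + c * l * (1 - exp (- b * t))"
  have D: "?D \<noteq> 0" using v_flow_nonneg(1)[OF assms] by simp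
  have "((\<lambda>t. v_flow b c t l) has_real_derivative
     ((b * (- b * ?E) * l) * ?D - b * ?E * l * (c * l * (b * ?E))) / (?D * ?D)) (at t within S)"
    unfolding v_flow_def using D by (auto intro!: derivative_eq_intros)
  moreover have "((b * (- b * ?E) * l) * ?D - b * ?E * l * (c * l * (b * ?E))) / (?D * ?D) =
      - (b * v_flow b c t l + c * (v_flow b c t l)\<^sup>2)"
  proof -
    have "((b * (- b * E) * l) * D - b * E * l * (c * l * (b * E))) / (D * D) =
        - (b * (b * E * l / D) + c * (b * E * l / D)\<^sup>2)" if "D \<noteq> 0" for D E :: real
      using that by (simp add: field_simps power2_eq_square)
    from this[OF D] show ?thesis unfolding v_flow_def .
  qed
  ultimately show ?thesis by simp
qed

text \<open>The bridge between the real inner integral of \<open>T_op\<close> and complex analysis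
  on the half plane.\<close>

lemma levy_exponent_of_real:
  assumes h: "integrable mu h" and v: "0 \<le> v"
  shows "levy_exponent h (of_real v) = of_real (LINT z:{0<..}|lborel. (1 - exp (- z * v)) * h z)"
proof -
  have [measurable]: "h \<in> borel_measurable mu" using h by simp
  have [measurable]: "(\<lambda>z::real. min 1 z) \<in> borel_measurable mu" "(\<lambda>z. exp (- z * v)) \<in> borel_measurable mu"
    by (intro borel_measurable_mu; measurable)+
  have "levy_exponent h (of_real v) = (LINT z|mu. complex_of_real (h z / min 1 z * (1 - exp (- z * v))))"
    unfolding levy_exponent_def by (simp flip: exp_of_real)
  also have "\<dots> = of_real (LINT z|mu. h z / min 1 z * (1 - exp (- z * v)))"
    by (rule integral_complex_of_real)
  also have "(LINT z|mu. h z / min 1 z * (1 - exp (- z * v))) =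
      (LINT z:{0<..}|lborel. min 1 z *\<^sub>R (h z / min 1 z * (1 - exp (- z * v))))"
    by (rule integral_mu) measurable
  also have "\<dots> = (LINT z:{0<..}|lborel. (1 - exp (- z * v)) * h z)"
    by (intro set_lebesgue_integral_cong) (auto simp: min_def)
  finally show ?thesis .
qed

text \<open>On a convex open set every holomorphic function has a primitive; the denominator is u (b
  + c u), and both factors are nonzero when Re u > 0.\<close>

lemma levy_exponent_primitive:
  assumes "integrable mu h" "0 < b" "0 < c"
  shows "\<exists>\<Phi>. \<forall>u. 0 < Re u \<longrightarrow>
    (\<Phi> has_field_derivative levy_exponent h u / (of_real b * u + of_real c * u\<^sup>2)) (at u)"
proof -
  let ?H = "{u. 0 < Re u}"
  have nz: "of_real b * u + of_real c * u\<^sup>2 \<noteq> 0" if "0 < Re u" for u :: complex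
  proof
    assume "of_real b * u + of_real c * u\<^sup>2 = 0"
    then have "u * (of_real b + of_real c * u) = 0" by (simp add: algebra_simps power2_eq_square)
    moreover have "u \<noteq> 0" using that by auto
    ultimately have "Re (of_real b + of_real c * u) = 0" by (metis mult_eq_0_iff zero_complex.sel(1))
    moreover have "0 < c * Re u" using assms that by simp
    ultimately show False using assms by simp
  qed
  have "(levy_exponent h) holomorphic_on ?H"
    unfolding holomorphic_on_open[OF open_halfspace_Re_gt]
    using levy_exponent_has_field_derivative[OF assms(1)] by blast
  then have "(\<lambda>u. levy_exponent h u / (of_real b * u + of_real c * u\<^sup>2)) holomorphic_on ?H"
    using nz by (intro holomorphic_intros) auto
  from holomorphic_convex_primitive'[OF convex_halfspace_Re_gt open_halfspace_Re_gt this]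
  obtain g where g: "\<And>x. x \<in> ?H \<Longrightarrow>
     (g has_field_derivative levy_exponent h x / (of_real b * x + of_real c * x\<^sup>2)) (at x within ?H)"
    by metis
  have "(g has_field_derivative levy_exponent h x / (of_real b * x + of_real c * x\<^sup>2)) (at x)" if "0 < Re x" for x
    using g[of x] that by (simp add: at_within_open[OF _ open_halfspace_Re_gt])
  then show ?thesis by blast
qed

text \<open>
  Along the flow, \<open>v' = - (b v + c v\<^sup>2)\<close>, so \<open>s \<mapsto> \<Phi> (v\<^sub>s l)\<close> is a primitive of
  minus the inner integral in \<open>T_op\<close>.
\<close>

lemma T_op_eq_primitive:
  assumes h: "integrable mu h" and bc: "0 < b" "0 < c" and l: "0 < l"
    and \<Phi>: "\<And>u. 0 < Re u \<Longrightarrow>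
      (\<Phi> has_field_derivative levy_exponent h u / (of_real b * u + of_real c * u\<^sup>2)) (at u)"
  shows "of_real (T_op b c h l) = \<Phi> (of_real l) - \<Phi> (of_real (v_flow b c 1 l))"
proof -
  let ?v = "\<lambda>s. v_flow b c s l"
  have v: "0 < ?v s" if "0 \<le> s" for s using v_flow_pos[OF bc that l] .
  have cont_v: "continuous_on {0..1} ?v"
    by (rule has_real_derivative_imp_continuous_on[where f' = "\<lambda>s. - (b * ?v s + c * (?v s)\<^sup>2)"])
      (use v_flow_deriv[OF bc] l in auto)
  have "(\<integral>s. indicator {0..1} s *\<^sub>R levy_exponent h (of_real (?v s)) \<partial>lborel) =
      - \<Phi> (of_real (?v 1)) - (- \<Phi> (of_real (?v 0)))"
  proof (rule integral_FTC_Icc)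
    fix s :: real assume s: "0 \<le> s" "s \<le> 1"
    have "((\<lambda>s. of_real (?v s)) has_vector_derivative complex_of_real (- (b * ?v s + c * (?v s)\<^sup>2))) (at s within {0..1})"
      using v_flow_deriv[OF bc s(1), of l] l
      by (intro has_vector_derivative_of_real) (auto simp: has_real_derivative_iff_has_vector_derivative)
    then have "((\<lambda>s. \<Phi> (of_real (?v s))) has_vector_derivative
        of_real (- (b * ?v s + c * (?v s)\<^sup>2)) *
          (levy_exponent h (of_real (?v s)) / (of_real b * of_real (?v s) + of_real c * (of_real (?v s))\<^sup>2))) (at s within {0..1})"
      using field_vector_diff_chain_within[OF _ has_field_derivative_at_within[OF \<Phi>]] v[OF s(1)]
      by (fastforce simp: o_def)
    moreover have "of_real (- (b * ?v s + c * (?v s)\<^sup>2)) *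
          (levy_exponent h (of_real (?v s)) / (of_real b * of_real (?v s) + of_real c * (of_real (?v s))\<^sup>2)) =
        - levy_exponent h (of_real (?v s))" (is "_ * (_ / ?d) = _")
    proof -
      have d: "?d = of_real (b * ?v s + c * (?v s)\<^sup>2)" by simp
      have "b * ?v s + c * (?v s)\<^sup>2 > 0" using v[OF s(1)] bc by (simp add: add_pos_pos)
      then show ?thesis unfolding d of_real_minus by (simp del: of_real_add of_real_mult of_real_power)
    qed
    ultimately have "((\<lambda>s. \<Phi> (of_real (?v s))) has_vector_derivative - levy_exponent h (of_real (?v s))) (at s within {0..1})"
      by simp
    from has_vector_derivative_minus[OF this]
    show "((\<lambda>s. - \<Phi> (of_real (?v s))) has_vector_derivative levy_exponent h (of_real (?v s))) (at s within {0..1})"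
      by simp
  next
    have "isCont (levy_exponent h) u" if "0 < Re u" for u
      using levy_exponent_has_field_derivative[OF h that] by (rule DERIV_isCont)
    then have "continuous_on {u. 0 < Re u} (levy_exponent h)"
      by (intro continuous_at_imp_continuous_on) auto
    then show "continuous_on {0..1} (\<lambda>s. levy_exponent h (of_real (?v s)))"
      by (rule continuous_on_compose2) (use v in \<open>auto intro!: continuous_intros cont_v\<close>)
  qed simp
  moreover have "(\<integral>s. indicator {0..1} s *\<^sub>R levy_exponent h (of_real (?v s)) \<partial>lborel) =
     of_real (T_op b c h l)"
    unfolding T_op_def set_lebesgue_integral_def[of lborel "{0..1}"] integral_complex_of_real[symmetric]
    using levy_exponent_of_real[OF h] v
    by (intro Bochner_Integration.integral_cong) (auto simp: indicator_def less_imp_le)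
  ultimately show ?thesis using v_flow_0[OF bc(1)] by simp
qed

text \<open>Read off from the primitive formula near l. Continuity later upgrades equality almost
  everywhere under the weight to equality on an interval.\<close>

lemma T_op_isCont:
  assumes h: "integrable mu h" and bc: "0 < b" "0 < c" and l: "0 < l"
  shows "isCont (T_op b c h) l"
proof -
  obtain \<Phi> where \<Phi>: "\<And>u. 0 < Re u \<Longrightarrow>
    (\<Phi> has_field_derivative levy_exponent h u / (of_real b * u + of_real c * u\<^sup>2)) (at u)"
    using levy_exponent_primitive[OF h bc] by blast
  let ?f = "\<lambda>l. Re (\<Phi> (of_real l) - \<Phi> (of_real (v_flow b c 1 l)))"
  have \<Phi>_cont: "isCont \<Phi> u" if "0 < Re u" for u using \<Phi>[OF that] by (rule DERIV_isCont)
  have "isCont (\<lambda>l. v_flow b c 1 l) l"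
    unfolding v_flow_def using v_flow_nonneg(1)[OF bc, of 1 l] l by (intro continuous_intros) auto
  then have v: "isCont (\<lambda>l. complex_of_real (v_flow b c 1 l)) l" by (rule isCont_of_real)
  have 1: "isCont (\<lambda>l. \<Phi> (of_real (v_flow b c 1 l))) l"
    by (rule isCont_o2[OF v \<Phi>_cont]) (use v_flow_pos[OF bc _ l, of 1] in simp)
  have 2: "isCont (\<lambda>l. \<Phi> (of_real l)) l"
    by (rule isCont_o2[OF isCont_of_real[OF continuous_ident] \<Phi>_cont]) (use l in simp)
  have "isCont ?f l" by (rule isCont_Re[OF isCont_diff[OF 2 1]])
  moreover have "eventually (\<lambda>x. x \<in> {0<..}) (nhds l)"
    by (rule eventually_nhds_in_open) (use l in auto)
  then have "eventually (\<lambda>x. T_op b c h x = ?f x) (nhds l)"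
    by eventually_elim (use T_op_eq_primitive[OF h bc _ \<Phi>] in \<open>metis Re_complex_of_real greaterThan_iff\<close>)
  ultimately show ?thesis using isCont_cong[of "T_op b c h" ?f l] by simp
qed

section \<open>The time-one flow map as a Moebius transformation of the right half plane\<close>

definition v1_complex :: "real \<Rightarrow> real \<Rightarrow> complex \<Rightarrow> complex" where
  "v1_complex b c u = of_real (b * exp (- b)) * u / (of_real b + of_real (c * (1 - exp (- b))) * u)"

lemma v1_complex_of_real: "v1_complex b c (of_real l) = of_real (v_flow b c 1 l)"
  by (simp add: v1_complex_def v_flow_def mult_ac exp_of_real)

text \<open>The denominator d has real part at least b, so |d| >= b, which leaves the contraction
  factor e^(-b). The sign of the real part is that of the numerator times \<open>cnj\<close> d,
  whose real part is p (b Re u + r |u|^2).\<close>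

lemma
  assumes "0 < b" "0 < c" "0 < Re u"
  shows v1_complex_denominator: "of_real b + of_real (c * (1 - exp (- b))) * u \<noteq> 0"
    and Re_v1_complex: "0 < Re (v1_complex b c u)"
    and norm_v1_complex: "norm (v1_complex b c u) \<le> exp (- b) * norm u"
proof -
  define p r where "p = b * exp (- b)" and "r = c * (1 - exp (- b))"
  let ?d = "of_real b + of_real r * u"
  have pr: "0 < p" "0 < r" using assms by (auto simp: p_def r_def)
  have "b \<le> Re ?d" using pr assms by simp
  also have "\<dots> \<le> norm ?d" by (rule complex_Re_le_cmod)
  finally have d: "b \<le> norm ?d" .
  have nz: "?d \<noteq> 0" using d assms(1) by (metis norm_zero not_le)
  then show "of_real b + of_real (c * (1 - exp (- b))) * u \<noteq> 0" by (simp add: r_def)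
  have v: "v1_complex b c u = of_real p * u / ?d" by (simp add: v1_complex_def p_def r_def)
  have "Re (of_real p * u * cnj ?d) = p * (b * Re u + r * (norm u)\<^sup>2)"
    unfolding cmod_power2 by (simp add: algebra_simps power2_eq_square)
  moreover have "0 < p * (b * Re u + r * (norm u)\<^sup>2)"
    using pr assms by (intro mult_pos_pos add_pos_nonneg) auto
  ultimately have "0 < Re (of_real p * u * cnj ?d)" by simp
  then show "0 < Re (v1_complex b c u)"
    unfolding v by (subst Re_complex_div_gt_0) simp
  have "norm (v1_complex b c u) = p * norm u / norm ?d"
    unfolding v using pr by (simp add: norm_divide norm_mult)
  also have "\<dots> \<le> p * norm u / b"
    using d assms pr by (intro divide_left_mono mult_nonneg_nonneg mult_pos_pos) auto
  finally show "norm (v1_complex b c u) \<le> exp (- b) * norm u"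
    using assms by (simp add: p_def)
qed

text \<open>With q(u) = b u + c u^2 the time-one map v satisfies v'(u) q(u) = q(v(u)), as the flow
  map of the field -q must. This makes the denominators cancel when Phi o v is
  differentiated.\<close>

lemma v1_complex_deriv:
  assumes "0 < b" "0 < c" "0 < Re u"
  shows "(v1_complex b c has_field_derivative
    (of_real b * v1_complex b c u + of_real c * (v1_complex b c u)\<^sup>2) /
    (of_real b * u + of_real c * u\<^sup>2)) (at u)"
proof -
  define e where "e = complex_of_real (exp (- b))"
  let ?b = "complex_of_real b" and ?c = "complex_of_real c"
  let ?d = "?b + ?c * (1 - e) * u"
  have v: "v1_complex b c = (\<lambda>u. ?b * e * u / (?b + ?c * (1 - e) * u))"
    by (simp add: v1_complex_def e_def fun_eq_iff)
  have d: "?d \<noteq> 0" using v1_complex_denominator[OF assms] by (simp add: e_def)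
  have u: "u \<noteq> 0" using assms by auto
  have q: "?b * u + ?c * u\<^sup>2 = u * (?b + ?c * u)" by (simp add: algebra_simps power2_eq_square)
  have "0 < Re (?b + ?c * u)" using assms by (simp add: add_pos_pos)
  then have w: "?b + ?c * u \<noteq> 0" by (metis less_irrefl zero_complex.sel(1))
  have "((\<lambda>u. ?b * e * u / (?b + ?c * (1 - e) * u)) has_field_derivative
      (?b * e * ?d - ?b * e * u * (?c * (1 - e))) / (?d * ?d)) (at u)"
    using d by (auto intro!: derivative_eq_intros)
  moreover have "(?b * e * ?d - ?b * e * u * (?c * (1 - e))) / (?d * ?d) =
      (?b * (?b * e * u / ?d) + ?c * (?b * e * u / ?d)\<^sup>2) / (?b * u + ?c * u\<^sup>2)"
  proof -
    have "?b * (A / D) + ?c * (A / D)\<^sup>2 = (?b * A * D + ?c * A\<^sup>2) / (D * D)" if "D \<noteq> 0" for A D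
      using that by (simp add: field_simps power2_eq_square)
    \<comment> \<open>The numerator collapses because d + c e u = b + c u for d = b + c (1 - e)
      u.\<close>
    from this[OF d, of "?b * e * u"]
    have "?b * (?b * e * u / ?d) + ?c * (?b * e * u / ?d)\<^sup>2 =
        (?b * ?b * e) * (u * (?b + ?c * u)) / (?d * ?d)"
      by (simp only:) (simp add: algebra_simps power2_eq_square)
    then have "(?b * (?b * e * u / ?d) + ?c * (?b * e * u / ?d)\<^sup>2) / (?b * u + ?c * u\<^sup>2) =
        (?b * ?b * e) / (?d * ?d)"
      unfolding q using u w by simp
    then show ?thesis by (simp add: algebra_simps)
  qed
  ultimately show ?thesis unfolding v by simp
qed

text \<open>
  With the primitive \<open>\<Phi>\<close> one has \<open>T h = \<Phi> - \<Phi> \<circ> v\<^sub>1\<close>. Both sides are analytic, so vanishing on an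
  interval means vanishing on the half plane; differentiating, \<open>\<phi> = \<phi> \<circ> v\<^sub>1\<close> for the exponent
  \<open>\<phi>\<close>, and iterating drives the argument to 0, where \<open>\<phi>\<close> vanishes.
\<close>

lemma levy_exponent_zero:
  assumes h: "integrable mu h" and bc: "0 < b" "0 < c" and ab: "0 \<le> \<alpha>" "\<alpha> < \<gamma>"
    and T: "\<And>l. \<alpha> < l \<Longrightarrow> l < \<gamma> \<Longrightarrow> T_op b c h l = 0"
    and u: "0 < Re u"
  shows "levy_exponent h u = 0"
proof -
  let ?H = "{u. 0 < Re u}" and ?q = "\<lambda>u. of_real b * u + of_real c * u\<^sup>2" and ?v = "v1_complex b c"
  obtain \<Phi> where \<Phi>: "\<And>u. 0 < Re u \<Longrightarrow> (\<Phi> has_field_derivative levy_exponent h u / ?q u) (at u)"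
    using levy_exponent_primitive[OF h bc] by blast
  have deriv: "((\<lambda>u. \<Phi> u - \<Phi> (?v u)) has_field_derivative
      levy_exponent h u / ?q u - levy_exponent h (?v u) / ?q (?v u) * (?q (?v u) / ?q u)) (at u)"
    if u: "0 < Re u" for u
    by (intro DERIV_diff \<Phi>[OF u] DERIV_chain2[OF \<Phi>] v1_complex_deriv Re_v1_complex bc u)
  have "(\<lambda>u. \<Phi> u - \<Phi> (?v u)) holomorphic_on ?H"
    unfolding holomorphic_on_open[OF open_halfspace_Re_gt] using deriv by blast
  then have zero: "\<Phi> u - \<Phi> (?v u) = 0" if "0 < Re u" for u
  proof (rule analytic_continuation[where U = "of_real ` {\<alpha><..<\<gamma>}" and \<xi> = "of_real ((\<alpha> + \<gamma>) / 2)"])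
    show "open ?H" by (rule open_halfspace_Re_gt)
    show "connected ?H" by (intro convex_connected convex_halfspace_Re_gt)
    show "of_real ` {\<alpha><..<\<gamma>} \<subseteq> ?H" using ab by auto
    show "of_real ((\<alpha> + \<gamma>) / 2) \<in> ?H" using ab by simp
    show "of_real ((\<alpha> + \<gamma>) / 2) islimpt complex_of_real ` {\<alpha><..<\<gamma>}"
    proof (rule islimpt_isCont_image)
      show "(\<alpha> + \<gamma>) / 2 islimpt {\<alpha><..<\<gamma>}"
        using ab by (intro interior_limit_point) (simp add: interior_open)
      show "\<forall>\<^sub>F y in at ((\<alpha> + \<gamma>) / 2). complex_of_real y \<noteq> of_real ((\<alpha> + \<gamma>) / 2)"
        by (simp only: of_real_eq_iff eventually_neq_at_within)
    qed simp
    fix z assume "z \<in> complex_of_real ` {\<alpha><..<\<gamma>}"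
    then obtain l where l: "z = of_real l" "\<alpha> < l" "l < \<gamma>" by auto
    then have "0 < l" using ab by simp
    from T_op_eq_primitive[OF h bc this \<Phi>] show "\<Phi> z - \<Phi> (?v z) = 0"
      using T[OF l(2,3)] by (simp add: l v1_complex_of_real)
  qed (use that in auto)
  have nz: "?q u \<noteq> 0" if "0 < Re u" for u
  proof -
    have "0 < Re (of_real b + of_real c * u)" using bc that by (simp add: add_pos_pos)
    then have "of_real b + of_real c * u \<noteq> 0" by (metis less_irrefl zero_complex.sel(1))
    moreover have "u \<noteq> 0" using that by auto
    moreover have "?q u = u * (of_real b + of_real c * u)" by (simp add: algebra_simps power2_eq_square)
    ultimately show ?thesis by simp
  qed
  \<comment> \<open>In the vanishing derivative the factor q(v u) cancels, leaving (\<phi>(u) -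
    \<phi>(v u)) / q(u) = 0.\<close>
  have inv: "levy_exponent h (?v u) = levy_exponent h u" if u: "0 < Re u" for u
  proof -
    have "((\<lambda>u. \<Phi> u - \<Phi> (?v u)) has_field_derivative 0) (at u)"
    proof (rule has_field_derivative_transform_within_open[of "\<lambda>_. 0" _ _ ?H])
      show "open ?H" by (rule open_halfspace_Re_gt)
    qed (use zero u in auto)
    from DERIV_unique[OF deriv[OF u] this]
    show ?thesis using nz[OF u] nz[OF Re_v1_complex[OF bc u]] by simp
  qed
  \<comment> \<open>Membership in the half plane is carried along because invariance and contraction
    are stated there.\<close>
  have iter: "0 < Re ((?v ^^ n) u) \<and> levy_exponent h ((?v ^^ n) u) = levy_exponent h u \<and>
      norm ((?v ^^ n) u) \<le> exp (- b) ^ n * norm u" for n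
  proof (induction n)
    case (Suc n)
    have "norm ((?v ^^ Suc n) u) \<le> exp (- b) * norm ((?v ^^ n) u)"
      using norm_v1_complex[OF bc] Suc by simp
    also have "\<dots> \<le> exp (- b) * (exp (- b) ^ n * norm u)"
      using Suc by (intro mult_left_mono) auto
    finally show ?case using Suc Re_v1_complex[OF bc] inv by (simp add: mult.assoc)
  qed (use u in simp)
  have "(\<lambda>n. (?v ^^ n) u) \<longlonglongrightarrow> 0"
  proof (rule tendsto_norm_zero_cancel, rule tendsto_sandwich[OF _ _ tendsto_const])
    have "(\<lambda>n. exp (- b) ^ n) \<longlonglongrightarrow> 0" using bc by (intro LIMSEQ_realpow_zero) auto
    from tendsto_mult_left_zero[OF this]
    show "(\<lambda>n. exp (- b) ^ n * norm u) \<longlonglongrightarrow> 0" .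
  qed (use iter in auto)
  then have "(\<lambda>n. levy_exponent h ((?v ^^ n) u)) \<longlonglongrightarrow> 0"
    by (rule levy_exponent_tendsto_0[OF h]) (use iter less_imp_le in blast)
  then show ?thesis using iter by (simp add: LIMSEQ_const_iff)
qed

section \<open>Measurable minimizers on a compact metric space\<close>

context Metric_space
begin

text \<open>Dominated convergence speaks of sequences; in a metric space sequential closedness of
  preimages is enough for continuity.\<close>

lemma continuous_map_real_sequentially:
  fixes F :: "'a \<Rightarrow> real"
  assumes "\<And>\<sigma> l. range \<sigma> \<subseteq> M \<Longrightarrow> limitin mtopology \<sigma> l sequentially \<Longrightarrow> (\<lambda>n. F (\<sigma> n)) \<longlonglongrightarrow> F l"
  shows "continuous_map mtopology euclideanreal F"
  unfolding continuous_map_closedin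
proof (intro conjI allI impI)
  fix C :: "real set" assume "closedin euclideanreal C"
  then have C: "closed C" by simp
  show "closedin mtopology {x \<in> topspace mtopology. F x \<in> C}"
    unfolding metric_closedin_iff_sequentially_closed
  proof (intro conjI allI impI)
    fix \<sigma> l
    assume *: "range \<sigma> \<subseteq> {x \<in> topspace mtopology. F x \<in> C} \<and> limitin mtopology \<sigma> l sequentially"
    then have lim: "(\<lambda>n. F (\<sigma> n)) \<longlonglongrightarrow> F l" by (intro assms) auto
    have mem: "F (\<sigma> n) \<in> C" for n using * by blast
    have "F l \<in> C" by (rule closed_sequentially[OF C mem lim])
    moreover have "l \<in> M" using * limitin_mspace by blast
    ultimately show "l \<in> {x \<in> topspace mtopology. F x \<in> C}" by simp
  qed auto
qed auto

lemma compactin_attains_min: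
  fixes F :: "'a \<Rightarrow> real"
  assumes "continuous_map mtopology euclideanreal F" "compactin mtopology S" "S \<noteq> {}"
  obtains f where "f \<in> S" "\<And>g. g \<in> S \<Longrightarrow> F f \<le> F g"
proof -
  have "compact (F ` S)" using image_compactin[OF assms(2,1)] by simp
  then show ?thesis using compact_attains_inf[of "F ` S"] assms(3) that by auto
qed

text \<open>Density in the form needed later: a strict sublevel set of a continuous function that
  meets \<open>S\<close> also meets \<open>D\<close>. One \<open>D\<close>, a union of finite 1 / (n
  + 1)-nets, serves all functions at once, so it can be fixed before the data vary.\<close>

lemma compactin_countable_dense:
  assumes "compactin mtopology S"
  shows "\<exists>D. countable D \<and> D \<subseteq> S \<and>
    (\<forall>x\<in>S. \<forall>F c. continuous_map mtopology euclideanreal F \<longrightarrow> F x < c \<longrightarrow> (\<exists>f\<in>D. F f < c))"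
proof -
  have "\<exists>K. finite K \<and> K \<subseteq> S \<and> S \<subseteq> (\<Union>x\<in>K. mball x (1 / real (Suc n)))" for n
    using compactin_imp_mtotally_bounded[OF assms] unfolding mtotally_bounded_def by simp
  then obtain K where K: "\<And>n. finite (K n)" "\<And>n. K n \<subseteq> S"
    "\<And>n. S \<subseteq> (\<Union>x\<in>K n. mball x (1 / real (Suc n)))" by metis
  show ?thesis
  proof (intro exI[of _ "\<Union>n. K n"] conjI ballI allI impI)
    show "countable (\<Union>n. K n)" using K(1) by (intro countable_UN) (auto simp: countable_finite)
    show "(\<Union>n. K n) \<subseteq> S" using K(2) by auto
    fix x and F :: "'a \<Rightarrow> real" and c
    assume x: "x \<in> S" and F: "continuous_map mtopology euclideanreal F" "F x < c"
    have xM: "x \<in> M" using x compactin_subset_topspace[OF assms] by auto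
    have "openin mtopology {y \<in> topspace mtopology. F y \<in> {..<c}}"
      using F(1) by (rule openin_continuous_map_preimage) simp
    then obtain r where r: "0 < r" "mball x r \<subseteq> {y \<in> topspace mtopology. F y \<in> {..<c}}"
      using F(2) xM unfolding openin_mtopology by auto
    obtain n where "1 / real (Suc n) < r" using r(1) nat_approx_posE by blast
    moreover obtain f where "f \<in> K n" "x \<in> mball f (1 / real (Suc n))" using K(3)[of n] x by blast
    ultimately have "f \<in> mball x r" by (auto simp: commute)
    with r(2) have "F f < c" by blast
    with \<open>f \<in> K n\<close> show "\<exists>f\<in>\<Union>n. K n. F f < c" by blast
  qed
qed

text \<open>
  For closed \<open>C\<close> the minimizer lies in \<open>C\<close> iff the infimum over \<open>C\<close> does not exceed the infimum
  over the whole space; by compactness both may be computed over countable dense subsets.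
\<close>

lemma measurable_arg_min:
  fixes crit :: "'x \<Rightarrow> 'a \<Rightarrow> real"
  assumes compact: "compact_space mtopology"
    and cont: "\<And>x. x \<in> space N \<Longrightarrow> continuous_map mtopology euclideanreal (crit x)"
    and meas: "\<And>f. f \<in> M \<Longrightarrow> (\<lambda>x. crit x f) \<in> borel_measurable N"
    and mem: "\<And>x. x \<in> space N \<Longrightarrow> e x \<in> M"
    and min: "\<And>x f. x \<in> space N \<Longrightarrow> f \<in> M \<Longrightarrow> f \<noteq> e x \<Longrightarrow> crit x (e x) < crit x f"
    and U: "openin mtopology U"
  shows "{x \<in> space N. e x \<in> U} \<in> sets N"
proof -
  define C where "C = M - U"
  have C: "compactin mtopology C"
    using U unfolding C_def by (intro closedin_compact_space[OF compact])
      (metis closedin_topspace closedin_diff topspace_mtopology)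
  obtain D where D: "countable D" "D \<subseteq> C"
    "\<forall>x\<in>C. \<forall>F c. continuous_map mtopology euclideanreal F \<longrightarrow> F x < c \<longrightarrow> (\<exists>f\<in>D. F f < c)"
    using compactin_countable_dense[OF C] by (elim exE conjE)
  obtain E where E: "countable E" "E \<subseteq> M"
    "\<forall>x\<in>M. \<forall>F c. continuous_map mtopology euclideanreal F \<longrightarrow> F x < c \<longrightarrow> (\<exists>f\<in>E. F f < c)"
    using compactin_countable_dense[OF compact[unfolded compact_space_def topspace_mtopology]] by (elim exE conjE)
  \<comment> \<open>The right-hand side compares the infima over \<open>D\<close> and
    \<open>E\<close>; the slack 1 / (k + 1) allows for infima that are not attained on the countable
    sets.\<close>
  have iff: "e x \<in> C \<longleftrightarrow> (\<forall>g\<in>E. \<forall>k::nat. \<exists>f\<in>D. crit x f < crit x g + 1 / real (Suc k))"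
    if x: "x \<in> space N" for x
  proof
    assume e: "e x \<in> C"
    show "\<forall>g\<in>E. \<forall>k::nat. \<exists>f\<in>D. crit x f < crit x g + 1 / real (Suc k)"
    proof (intro ballI allI)
      fix g k assume "g \<in> E"
      then have "crit x (e x) \<le> crit x g"
        using min[OF x, of g] E(2) by (cases "g = e x") (simp, blast intro: less_imp_le)
      moreover have "0 < 1 / real (Suc k)" by simp
      ultimately have "crit x (e x) < crit x g + 1 / real (Suc k)" by linarith
      then show "\<exists>f\<in>D. crit x f < crit x g + 1 / real (Suc k)"
        by (rule D(3)[rule_format, OF e cont[OF x]])
    qed
  next
    assume *: "\<forall>g\<in>E. \<forall>k::nat. \<exists>f\<in>D. crit x f < crit x g + 1 / real (Suc k)"
    \<comment> \<open>This only produces an element of \<open>E\<close>; with it the assumption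
      forces \<open>D\<close>, hence \<open>C\<close>, to be nonempty, and a minimizer over
      \<open>C\<close> exists.\<close>
    have "\<exists>g\<in>E. crit x g < crit x (e x) + 1"
      by (rule E(3)[rule_format, OF mem[OF x] cont[OF x]]) simp
    then obtain g where "g \<in> E" by blast
    then have "C \<noteq> {}" using * D(2) by blast
    then obtain f\<^sub>0 where f0: "f\<^sub>0 \<in> C" "\<And>g. g \<in> C \<Longrightarrow> crit x f\<^sub>0 \<le> crit x g"
      using compactin_attains_min[OF cont[OF x] C] by metis
    have "f\<^sub>0 = e x"
    proof (rule ccontr)
      assume "f\<^sub>0 \<noteq> e x"
      then have "crit x (e x) < crit x f\<^sub>0" using min[OF x] f0(1) by (auto simp: C_def)
      then obtain g where g: "g \<in> E" "crit x g < crit x f\<^sub>0"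
        using E(3)[rule_format, OF mem[OF x] cont[OF x]] by blast
      then obtain k where k: "1 / real (Suc k) < crit x f\<^sub>0 - crit x g"
        using nat_approx_posE[of "crit x f\<^sub>0 - crit x g"] by auto
      obtain f where "f \<in> D" "crit x f < crit x g + 1 / real (Suc k)" using * g(1) by blast
      then show False using f0(2)[of f] D(2) k by auto
    qed
    then show "e x \<in> C" using f0(1) by simp
  qed
  have "{x \<in> space N. \<forall>g\<in>E. \<forall>k::nat. \<exists>f\<in>D. crit x f < crit x g + 1 / real (Suc k)} \<in> sets N"
  proof (intro sets.sets_Collect_countable_All'[OF _ E(1)] sets.sets_Collect_countable_All
      sets.sets_Collect_countable_Ex'[OF _ D(1)])
    fix g k f assume "g \<in> E" "f \<in> D"
    then have [measurable]: "(\<lambda>x. crit x f) \<in> borel_measurable N" "(\<lambda>x. crit x g) \<in> borel_measurable N"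
      using meas E(2) D(2) by (auto simp: C_def)
    show "{x \<in> space N. crit x f < crit x g + 1 / real (Suc k)} \<in> sets N" by measurable
  qed
  moreover have "{x \<in> space N. e x \<in> U} = space N - {x \<in> space N. \<forall>g\<in>E. \<forall>k::nat. \<exists>f\<in>D. crit x f < crit x g + 1 / real (Suc k)}"
    using iff mem by (auto simp: C_def)
  ultimately show ?thesis by simp
qed

end

section \<open>Bounds for \<open>T_op\<close> and the weight measure\<close>

lemma norm_levy_exponent_le:
  assumes "integrable mu h" "0 \<le> Re u"
  shows "norm (levy_exponent h u) \<le> max 2 (norm u) * mu_abs h"
proof -
  have "norm (levy_exponent h u) \<le> (LINT z|mu. norm (of_real (h z / min 1 z) * (1 - exp (- (of_real z * u)))))"
    unfolding levy_exponent_def by (rule integral_norm_bound)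
  also have "\<dots> \<le> (LINT z|mu. max 2 (norm u) * \<bar>h z\<bar>)"
    using assms norm_levy_integrand_le[OF _ assms(2)]
    by (intro integral_mono integrable_norm integrable_levy_integrand) auto
  finally show ?thesis by (simp add: mu_abs_def)
qed

lemma levy_exponent_linear:
  assumes f: "integrable mu f" and g: "integrable mu g" and u: "0 \<le> Re u"
  shows "levy_exponent (\<lambda>z. p * f z + q * g z) u = of_real p * levy_exponent f u + of_real q * levy_exponent g u"
proof -
  let ?k = "\<lambda>h z. complex_of_real (h z / min 1 z) * (1 - exp (- (of_real z * u)))"
  have "levy_exponent (\<lambda>z. p * f z + q * g z) u = (LINT z|mu. of_real p * ?k f z + of_real q * ?k g z)"
    unfolding levy_exponent_def
    by (intro Bochner_Integration.integral_cong refl) (simp add: add_divide_distrib algebra_simps)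
  also have "\<dots> = of_real p * levy_exponent f u + of_real q * levy_exponent g u"
    unfolding levy_exponent_def
    using integrable_levy_integrand[OF f u] integrable_levy_integrand[OF g u]
    by (simp only: Bochner_Integration.integral_add integrable_mult_right integral_mult_right_zero)
  finally show ?thesis .
qed

text \<open>The inner integral as a function of the flow value alone, so that measurability in time
  and argument follows by composition with \<open>v_flow\<close>.\<close>

definition T_inner :: "(real \<Rightarrow> real) \<Rightarrow> real \<Rightarrow> real" where
  "T_inner h v = (LINT z:{0<..}|lborel. (1 - exp (- z * v)) * h z)"

lemma T_op_T_inner: "T_op b c h l = (LINT s:{0..1}|lborel. T_inner h (v_flow b c s l))"
  by (simp add: T_op_def T_inner_def)

lemma T_inner_measurable [measurable]:
  assumes "h \<in> borel_measurable mu"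
  shows "T_inner h \<in> borel_measurable borel"
proof -
  have [measurable]: "(\<lambda>z. indicator {0<..} z *\<^sub>R h z) \<in> borel_measurable borel"
    using assms by (simp only: measurable_mu_iff)
  have "T_inner h = (\<lambda>v. LINT z|lborel. (1 - exp (- z * v)) * (indicator {0<..} z *\<^sub>R h z))"
    by (simp add: T_inner_def set_lebesgue_integral_def fun_eq_iff mult_ac)
  also have "\<dots> \<in> borel_measurable borel" by measurable
  finally show ?thesis .
qed

lemma v_flow_measurable [measurable]:
  assumes [measurable]: "f \<in> borel_measurable N" "g \<in> borel_measurable N"
  shows "(\<lambda>x. v_flow b c (f x) (g x)) \<in> borel_measurable N"
  unfolding v_flow_def by measurable

lemma T_op_measurable [measurable]:
  assumes "h \<in> borel_measurable mu"
  shows "T_op b c h \<in> borel_measurable borel"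
proof -
  note T_inner_measurable[OF assms, measurable]
  have "(\<lambda>l. LINT s|lborel. indicator {0..1} s *\<^sub>R T_inner h (v_flow b c s l)) \<in> borel_measurable borel"
    by measurable
  then show ?thesis unfolding T_op_T_inner[abs_def] set_lebesgue_integral_def .
qed

lemma T_inner_bound:
  assumes "integrable mu h" "0 \<le> v" "v \<le> l"
  shows "\<bar>T_inner h v\<bar> \<le> max 2 l * mu_abs h"
proof -
  have "\<bar>T_inner h v\<bar> \<le> max 2 v * mu_abs h"
    using norm_levy_exponent_le[OF assms(1), of "of_real v"] levy_exponent_of_real[OF assms(1,2)] assms(2)
    by (simp add: T_inner_def)
  also have "\<dots> \<le> max 2 l * mu_abs h"
    using assms(3) by (intro mult_right_mono) (auto simp: mu_abs_def)
  finally show ?thesis .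
qed

lemma
  assumes h: "integrable mu h" and bc: "0 < b" "0 < c" and l: "0 \<le> l"
  shows T_inner_integrable: "set_integrable lborel {0..1} (\<lambda>s. T_inner h (v_flow b c s l))"
    and T_op_bound: "\<bar>T_op b c h l\<bar> \<le> max 2 l * mu_abs h"
proof -
  note T_inner_measurable[OF borel_measurable_integrable[OF h], measurable]
  let ?B = "max 2 l * mu_abs h"
  have bound: "\<bar>T_inner h (v_flow b c s l)\<bar> \<le> ?B" if "0 \<le> s" for s
    using T_inner_bound[OF h] v_flow_nonneg[OF bc that l] by blast
  have int: "integrable lborel (\<lambda>s. indicator {0..1::real} s *\<^sub>R ?B)" by simp
  have le: "norm (indicator {0..1} s *\<^sub>R T_inner h (v_flow b c s l)) \<le> indicator {0..1} s *\<^sub>R ?B" for s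
    using bound[of s] by (auto simp: indicator_def)
  show i: "set_integrable lborel {0..1} (\<lambda>s. T_inner h (v_flow b c s l))"
    unfolding set_integrable_def
  proof (rule Bochner_Integration.integrable_bound[OF int])
    show "AE s in lborel. norm (indicator {0..1} s *\<^sub>R T_inner h (v_flow b c s l)) \<le> norm (indicator {0..1} s *\<^sub>R ?B)"
      by (intro AE_I2 order_trans[OF le]) simp
  qed measurable
  have "\<bar>T_op b c h l\<bar> \<le> (LINT s|lborel. norm (indicator {0..1} s *\<^sub>R T_inner h (v_flow b c s l)))"
    unfolding T_op_T_inner set_lebesgue_integral_def real_norm_def[symmetric] by (rule integral_norm_bound)
  also have "\<dots> \<le> (LINT s|lborel. indicator {0..1::real} s *\<^sub>R ?B)"
    using i int le unfolding set_integrable_def by (intro integral_mono integrable_norm) auto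
  finally show "\<bar>T_op b c h l\<bar> \<le> ?B" by simp
qed

text \<open>The inner integral inherits linearity from the complex exponent, since the reals embed
  injectively; the outer one uses \<open>T_inner_integrable\<close>.\<close>

lemma T_op_linear:
  assumes f: "integrable mu f" and g: "integrable mu g" and bc: "0 < b" "0 < c" and l: "0 \<le> l"
  shows "T_op b c (\<lambda>z. p * f z + q * g z) l = p * T_op b c f l + q * T_op b c g l"
proof -
  have inner: "T_inner (\<lambda>z. p * f z + q * g z) v = p * T_inner f v + q * T_inner g v" if v: "0 \<le> v" for v
  proof -
    have "integrable mu (\<lambda>z. p * f z + q * g z)" using f g by simp
    from levy_exponent_of_real[OF this v] levy_exponent_of_real[OF f v] levy_exponent_of_real[OF g v]
      levy_exponent_linear[OF f g, of "of_real v" p q] v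
    have "complex_of_real (T_inner (\<lambda>z. p * f z + q * g z) v) = of_real (p * T_inner f v + q * T_inner g v)"
      by (simp add: T_inner_def)
    then show ?thesis by (simp only: of_real_eq_iff)
  qed
  have "T_op b c (\<lambda>z. p * f z + q * g z) l =
      (LINT s:{0..1}|lborel. p * T_inner f (v_flow b c s l) + q * T_inner g (v_flow b c s l))"
    unfolding T_op_T_inner using v_flow_nonneg(2)[OF bc _ l]
    by (intro set_lebesgue_integral_cong) (auto intro!: inner)
  also have "\<dots> = p * T_op b c f l + q * T_op b c g l"
    unfolding T_op_T_inner using T_inner_integrable[OF f bc l] T_inner_integrable[OF g bc l]
    by (subst set_integral_add) auto
  finally show ?thesis .
qed

lemma T_op_diff:
  assumes "integrable mu f" "integrable mu g" "0 < b" "0 < c" "0 \<le> l"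
  shows "T_op b c (\<lambda>z. f z - g z) l = T_op b c f l - T_op b c g l"
  using T_op_linear[OF assms, of 1 "- 1"] by simp

section \<open>The weight as a finite measure\<close>

definition weight_measure :: "(real \<Rightarrow> real) \<Rightarrow> real measure" where
  "weight_measure w = density lborel (\<lambda>l. ennreal (indicator {0..} l * w l))"

lemma sets_weight_measure [simp, measurable_cong]: "sets (weight_measure w) = sets borel"
  by (simp add: weight_measure_def)

lemma space_weight_measure [simp]: "space (weight_measure w) = UNIV"
  by (simp add: weight_measure_def)

lemma weight_measurable:
  assumes "weight_function w"
  shows "(\<lambda>l. indicator {0..} l * w l) \<in> borel_measurable borel"
  using assms by (simp add: weight_function_def borel_measurable_restrict_space_iff)

lemma AE_weight_measure_iff:
  assumes "weight_function w"
  shows "(AE l in weight_measure w. P l) \<longleftrightarrow> (AE l in lborel. 0 \<le> l \<and> w l \<noteq> 0 \<longrightarrow> P l)"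
proof -
  note weight_measurable[OF assms, measurable]
  have "(AE l in weight_measure w. P l) \<longleftrightarrow> (AE l in lborel. 0 < ennreal (indicator {0..} l * w l) \<longrightarrow> P l)"
    unfolding weight_measure_def by (rule AE_density) measurable
  also have "(\<lambda>l. 0 < ennreal (indicator {0..} l * w l)) = (\<lambda>l. 0 \<le> l \<and> w l \<noteq> 0)"
    using assms by (auto simp: weight_function_def fun_eq_iff indicator_def order_less_le)
  finally show ?thesis by simp
qed

lemma sets_weight_nonzero:
  assumes "weight_function w" "A \<in> sets borel"
  shows "{y \<in> A. 0 \<le> y \<and> w y \<noteq> 0} \<in> sets borel"
proof -
  note weight_measurable[OF assms(1), measurable] assms(2)[measurable]
  have "{y \<in> A. 0 \<le> y \<and> w y \<noteq> 0} = A \<inter> {y \<in> space borel. indicator {0..} y * w y \<noteq> 0}"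
    by (auto simp: indicator_def)
  also have "\<dots> \<in> sets borel" by measurable
  finally show ?thesis .
qed

text \<open>Every point of the half line outside the support has a ball on which \<open>w\<close>
  vanishes almost everywhere; the Lindelof property reduces the union of such balls to a countable
  one.\<close>

lemma AE_weight_support:
  assumes w: "weight_function w"
  shows "AE y in lborel. 0 \<le> y \<and> w y \<noteq> 0 \<longrightarrow> y \<in> weight_support w"
proof -
  define S where "S = {y. 0 \<le> y \<and> w y \<noteq> 0}"
  define \<F> where "\<F> = {ball l e | l e. 0 < e \<and> emeasure lborel (ball l e \<inter> S) = 0}"
  have S_ball: "{y \<in> ball l e. 0 \<le> y \<and> w y \<noteq> 0} = ball l e \<inter> S" for l e by (auto simp: S_def)
  obtain \<F>' where F': "\<F>' \<subseteq> \<F>" "countable \<F>'" "\<Union>\<F>' = \<Union>\<F>"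
    using Lindelof[of \<F>] by (auto simp: \<F>_def)
  have "B \<inter> S \<in> null_sets lborel" if "B \<in> \<F>'" for B
  proof -
    obtain l e where B: "B = ball l e" "emeasure lborel (ball l e \<inter> S) = 0"
      using F'(1) \<open>B \<in> \<F>'\<close> by (auto simp: \<F>_def)
    have "ball l e \<inter> S \<in> sets borel"
      unfolding S_ball[symmetric] by (rule sets_weight_nonzero[OF w]) simp
    then show ?thesis using B by (auto intro: null_setsI)
  qed
  then have "(\<Union>B\<in>\<F>'. B \<inter> S) \<in> null_sets lborel" using F'(2) by (intro null_sets_UN') auto
  then have "AE y in lborel. y \<notin> (\<Union>B\<in>\<F>'. B \<inter> S)" by (rule AE_not_in)
  then show ?thesis
  proof eventually_elim
    fix y assume y: "y \<notin> (\<Union>B\<in>\<F>'. B \<inter> S)"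
    show "0 \<le> y \<and> w y \<noteq> 0 \<longrightarrow> y \<in> weight_support w"
    proof
      assume "0 \<le> y \<and> w y \<noteq> 0"
      then have "y \<in> S" by (simp add: S_def)
      with y F'(3) have "y \<notin> \<Union>\<F>" by blast
      then have "emeasure lborel (ball y e \<inter> S) \<noteq> 0" if "0 < e" for e
        using that centre_in_ball unfolding \<F>_def by blast
      then show "y \<in> weight_support w" using \<open>0 \<le> y \<and> w y \<noteq> 0\<close>
        unfolding weight_support_def S_ball by (simp add: zero_less_iff_neq_zero)
    qed
  qed
qed

lemma
  assumes w: "weight_function w"
  shows finite_weight_measure: "finite_measure (weight_measure w)"
    and weight_measure_bounded: "\<exists>L. AE l in weight_measure w. 0 \<le> l \<and> l \<le> L"
proof -
  note weight_measurable[OF w, measurable]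
  have "bounded (weight_support w)" using w by (simp add: weight_function_def compact_imp_bounded)
  then obtain L where L: "\<And>l. l \<in> weight_support w \<Longrightarrow> \<bar>l\<bar> \<le> L" unfolding bounded_real by blast
  have ae: "AE l in lborel. 0 \<le> l \<and> w l \<noteq> 0 \<longrightarrow> 0 \<le> l \<and> l \<le> L"
    using AE_weight_support[OF w] by eventually_elim (use L in fastforce)
  then show "\<exists>L. AE l in weight_measure w. 0 \<le> l \<and> l \<le> L"
    unfolding AE_weight_measure_iff[OF w] by blast
  obtain C where C: "\<And>l. 0 \<le> l \<Longrightarrow> w l \<le> C" using w by (auto simp: weight_function_def)
  have "AE l in lborel. ennreal (indicator {0..} l * w l) \<le> ennreal C * indicator {0..L} l"
    using ae by eventually_elim (use C in \<open>auto simp: indicator_def intro!: ennreal_leI\<close>)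
  then have "(\<integral>\<^sup>+ l. ennreal (indicator {0..} l * w l) \<partial>lborel) \<le> (\<integral>\<^sup>+ l. ennreal C * indicator {0..L} l \<partial>lborel)"
    by (rule nn_integral_mono_AE)
  also have "\<dots> < \<infinity>"
    by (subst nn_integral_cmult_indicator) (auto simp: ennreal_mult_less_top emeasure_lborel_Icc_eq)
  finally show "finite_measure (weight_measure w)"
    unfolding weight_measure_def by (intro finite_measureI) (simp add: emeasure_density)
qed

section \<open>The estimator\<close>

lemma L_n_pos:
  assumes "1 \<le> n"
  shows "0 < L_n b \<beta> c n x l"
  unfolding L_n_def using assms by (intro mult_pos_pos sum_pos) auto

lemma g_n_bounded:
  assumes n: "1 \<le> n" and bc: "0 < b" "0 < c"
  shows "\<exists>G. \<forall>l. 0 \<le> l \<and> l \<le> L \<longrightarrow> \<bar>g_n b \<beta> c n x l\<bar> \<le> G"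
proof -
  have v: "b + c * l * (1 - exp (- b * 1)) \<noteq> 0" if "0 \<le> l" for l
    using v_flow_nonneg(1)[OF bc, of 1 l] that by simp
  have D: "1 + c * l * (1 - exp (- b)) / b > 0" if "0 \<le> l" for l
    using that bc by (intro add_pos_nonneg divide_nonneg_nonneg mult_nonneg_nonneg) auto
  have "continuous_on {0..L} (\<lambda>l. v_flow b c 1 l)"
    unfolding v_flow_def using v by (intro continuous_intros) auto
  moreover have "continuous_on {0..L} (D_fun b \<beta> c)"
    unfolding D_fun_def[abs_def] using D bc by (intro continuous_intros) (auto simp: less_imp_neq[symmetric])
  ultimately have "continuous_on {0..L} (L_n b \<beta> c n x)"
    unfolding L_n_def[abs_def] by (intro continuous_intros) auto
  then have "continuous_on {0..L} (g_n b \<beta> c n x)"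
    unfolding g_n_def[abs_def] using L_n_pos[OF n] by (intro continuous_intros) (auto simp: less_imp_neq[symmetric])
  then have "bounded (g_n b \<beta> c n x ` {0..L})"
    by (intro compact_imp_bounded compact_continuous_image) auto
  then obtain G where "\<forall>y\<in>g_n b \<beta> c n x ` {0..L}. \<bar>y\<bar> \<le> G" unfolding bounded_real by blast
  then show ?thesis by (intro exI[of _ G]) simp
qed

text \<open>Joint measurability in data and argument lets the integral over the argument stay
  measurable in the data.\<close>

lemma g_n_measurable:
  "(\<lambda>(x, l). g_n b \<beta> c n x l) \<in> borel_measurable (PiM {..n} (\<lambda>_. borel) \<Otimes>\<^sub>M borel)"
proof -
  have comp: "(\<lambda>p. fst p j) \<in> borel_measurable (PiM {..n} (\<lambda>_. borel) \<Otimes>\<^sub>M (borel :: real measure))"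
    if "j \<le> n" for j :: nat
    using that by (intro measurable_compose[OF measurable_fst measurable_component_singleton]) auto
  have D: "(\<lambda>p. D_fun b \<beta> c (snd p)) \<in> borel_measurable (PiM {..n} (\<lambda>_. borel) \<Otimes>\<^sub>M (borel :: real measure))"
    unfolding D_fun_def by measurable
  have "(\<lambda>p. exp (- snd p * fst p j + fst p (j - 1) * v_flow b c 1 (snd p) + D_fun b \<beta> c (snd p)))
      \<in> borel_measurable (PiM {..n} (\<lambda>_. borel) \<Otimes>\<^sub>M (borel :: real measure))" if "j \<in> {1..n}" for j
  proof -
    have "j \<le> n" "j - 1 \<le> n" using that by auto
    note comp[OF this(1), measurable] comp[OF this(2), measurable] D[measurable]
    show ?thesis by measurable
  qed
  then have [measurable]: "(\<lambda>p. L_n b \<beta> c n (fst p) (snd p))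
      \<in> borel_measurable (PiM {..n} (\<lambda>_. borel) \<Otimes>\<^sub>M (borel :: real measure))"
    unfolding L_n_def by (intro borel_measurable_times borel_measurable_const borel_measurable_sum)
  have "(\<lambda>p. g_n b \<beta> c n (fst p) (snd p)) \<in> borel_measurable (PiM {..n} (\<lambda>_. borel) \<Otimes>\<^sub>M (borel :: real measure))"
    unfolding g_n_def by measurable
  then show ?thesis by (simp add: case_prod_beta')
qed

lemma g_n_measurable_snd [measurable]: "g_n b \<beta> c n x \<in> borel_measurable borel"
  unfolding g_n_def[abs_def] L_n_def D_fun_def by measurable

section \<open>Minimization over \<open>K_R\<close> with the data as a parameter\<close>

locale minimum_contrast =
  fixes b \<beta> c :: real and w :: "real \<Rightarrow> real" and kR :: "nat \<Rightarrow> real \<Rightarrow> real"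
    and a\<^sub>0 b\<^sub>0 :: real and R n :: nat
  assumes bc: "0 < b" "0 < c"
    and env: "envelope_sequence kR"
    and w: "weight_function w"
    and ab: "0 \<le> a\<^sub>0" "a\<^sub>0 < b\<^sub>0" "{a\<^sub>0..b\<^sub>0} \<subseteq> weight_support w"
    and R: "1 \<le> R" and n: "1 \<le> n"
begin

abbreviation "\<nu> \<equiv> weight_measure w"
abbreviation "K \<equiv> K_R kR R"
abbreviation "T \<equiv> T_op b c"
abbreviation "g \<equiv> g_n b \<beta> c n"
abbreviation "crit \<equiv> criterion b \<beta> c w n"

lemma kR_integrable: "integrable mu (kR R)" and kR_nonneg: "0 < z \<Longrightarrow> 0 \<le> kR R z"
  using env R unfolding envelope_sequence_def by blast+

lemma K_integrable: "f \<in> K \<Longrightarrow> integrable mu f"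
  by (simp add: K_R_iff K_all_def L_mu_def)

lemma K_L_mu: "K \<subseteq> L_mu"
  by (auto simp: K_R_iff K_all_def)

lemma mu_abs_K:
  assumes "f \<in> K"
  shows "mu_abs f \<le> mu_abs (kR R)"
proof -
  obtain h where h: "AE z in mu. f z = h z" "\<And>z. 0 < z \<Longrightarrow> h z \<le> kR R z"
    using assms by (auto simp: K_R_iff)
  have pos: "0 \<le> f z" if "0 < z" for z using assms that by (auto simp: K_R_iff K_all_def)
  have "AE z in mu. \<bar>f z\<bar> \<le> \<bar>kR R z\<bar>"
    using h(1) AE_space
  proof eventually_elim
    case (elim z)
    then show ?case using h(2)[of z] pos[of z] by simp
  qed
  then show ?thesis unfolding mu_abs_def
    using K_integrable[OF assms] kR_integrable by (intro integral_mono_AE) auto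
qed

text \<open>On the half line right-continuity decides; elsewhere both functions are
  \<open>undefined\<close>. Hence \<open>mu_abs\<close>, only a seminorm on \<open>L_mu\<close>,
  yields a genuine metric on \<open>K\<close>.\<close>

lemma K_eqI:
  assumes f: "f \<in> K" and h: "h \<in> K" and ae: "AE z in mu. f z = h z"
  shows "f = h"
proof
  fix z
  show "f z = h z"
  proof (cases "0 < z")
    case True
    then show ?thesis using right_continuous_eq[OF ae True] f h by (auto simp: K_R_iff K_all_def)
  next
    case False
    then show ?thesis using f h by (auto simp: K_R_iff K_all_def L_mu_def extensional_def)
  qed
qed

lemma Metric_space_K: "Metric_space K (\<lambda>f h. mu_abs (\<lambda>z. f z - h z))"
proof
  fix f h k
  show "0 \<le> mu_abs (\<lambda>z. f z - h z)" by (simp add: mu_abs_def)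
  show "mu_abs (\<lambda>z. f z - h z) = mu_abs (\<lambda>z. h z - f z)" by (simp add: mu_abs_def abs_minus_commute)
  assume K: "f \<in> K" "h \<in> K"
  note int = K_integrable[OF K(1)] K_integrable[OF K(2)]
  show "mu_abs (\<lambda>z. f z - h z) = 0 \<longleftrightarrow> f = h"
    unfolding mu_abs_def using int
    by (subst integral_nonneg_eq_0_iff_AE) (auto intro: K_eqI[OF K])
  assume "k \<in> K"
  note int3 = K_integrable[OF this]
  have "mu_abs (\<lambda>z. f z - k z) \<le> (LINT z|mu. \<bar>f z - h z\<bar> + \<bar>h z - k z\<bar>)"
    unfolding mu_abs_def using int int3 by (intro integral_mono) auto
  also have "\<dots> = mu_abs (\<lambda>z. f z - h z) + mu_abs (\<lambda>z. h z - k z)"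
    unfolding mu_abs_def using int int3 by (intro Bochner_Integration.integral_add) auto
  finally show "mu_abs (\<lambda>z. f z - k z) \<le> mu_abs (\<lambda>z. f z - h z) + mu_abs (\<lambda>z. h z - k z)" .
qed

sublocale K: Metric_space K "\<lambda>f h. mu_abs (\<lambda>z. f z - h z)"
  by (rule Metric_space_K)

lemma compact_K: "compact_space K.mtopology"
  unfolding K.compact_space_sequentially
proof (intro allI impI)
  fix \<sigma> :: "nat \<Rightarrow> real \<Rightarrow> real" assume \<sigma>: "range \<sigma> \<subseteq> K"
  obtain r f where rf: "strict_mono (r :: nat \<Rightarrow> nat)" "f \<in> K"
    "(\<lambda>n. mu_abs (\<lambda>z. \<sigma> (r n) z - f z)) \<longlonglongrightarrow> 0"
    by (rule K_R_seq_compact[where kR = kR and R = R, OF kR_integrable, of \<sigma>]) (use \<sigma> in auto)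
  then have "limitin K.mtopology (\<sigma> \<circ> r) f sequentially"
    unfolding K.limitin_metric_dist_null using \<sigma> by (auto simp: o_def intro!: always_eventually)
  with rf(1,2) show "\<exists>l r. l \<in> K \<and> strict_mono r \<and> limitin K.mtopology (\<sigma> \<circ> r) l sequentially"
    by (intro exI[of _ f] exI[of _ r] conjI)
qed

lemma K_nonempty: "K \<noteq> {}"
proof -
  \<comment> \<open>\<open>L_mu\<close> prescribes the value \<open>undefined\<close> off the half
    line, so the element is this restricted zero; the version carrying the bounds is zero on all
    reals.\<close>
  define f :: "real \<Rightarrow> real" where "f = (\<lambda>z\<in>{0<..}. 0)"
  have f: "f z = 0" if "0 < z" for z using that by (simp add: f_def)
  have tv: "total_variation \<alpha> \<gamma> (\<lambda>_. 0 :: real) \<le> 0" for \<alpha> \<gamma> by (rule total_variation_leI) simp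
  have tvf: "total_variation \<alpha> \<gamma> f \<le> 0" if "0 < \<alpha>" for \<alpha> \<gamma>
  proof (rule total_variation_leI)
    fix m and x :: "nat \<Rightarrow> real" assume x: "x 0 = \<alpha>" "x m = \<gamma>" "\<And>i. i < m \<Longrightarrow> x i < x (Suc i)"
    have "f (x i) = 0" if "i \<le> m" for i
      using partition_le[of m x 0 i] x that \<open>0 < \<alpha>\<close> by (intro f) auto
    then show "(\<Sum>i<m. ennreal \<bar>f (x (Suc i)) - f (x i)\<bar>) \<le> 0" by simp
  qed
  have "integrable mu f" by (subst Bochner_Integration.integrable_cong[of mu mu f "\<lambda>_. 0"]) (auto simp: f)
  moreover have "f \<in> extensional {0<..}" by (simp add: f_def)
  moreover have "continuous (at_right z) f" if "0 < z" for z
    unfolding continuous_within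
    by (rule tendsto_eventually) (use that in \<open>auto simp: f eventually_at_right_field intro!: exI[of _ "z + 1"]\<close>)
  moreover have "f \<in> locally_bv"
    unfolding locally_bv_def using tvf le_less_trans[OF tvf] by (auto simp: less_top[symmetric])
  ultimately have "f \<in> K_all" by (simp add: K_all_def L_mu_def f)
  moreover have "AE z in mu. f z = (\<lambda>_. 0) z" by (intro AE_I2) (simp add: f)
  moreover have "variation_bounds R (\<lambda>_. 0)"
    unfolding variation_bounds_def by (auto intro: order_trans[OF tv])
  ultimately have "f \<in> K"
    unfolding K_R_iff by (intro conjI exI[of _ "\<lambda>_. 0"] allI impI kR_nonneg)
  then show ?thesis by blast
qed

text \<open>The case of convexity that the parallelogram identity needs. Averaging the versions
  preserves the envelope, and the variation is convex (\<open>tv\<close>).\<close>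

lemma midpoint_K:
  assumes f: "f \<in> K" and h: "h \<in> K"
  shows "(\<lambda>z. 1 / 2 * f z + 1 / 2 * h z) \<in> K" (is "?m f h \<in> K")
proof -
  obtain f' where f': "AE z in mu. f z = f' z" "\<And>z. 0 < z \<Longrightarrow> f' z \<le> kR R z" "variation_bounds R f'"
    using f by (auto simp: K_R_iff)
  obtain h' where h': "AE z in mu. h z = h' z" "\<And>z. 0 < z \<Longrightarrow> h' z \<le> kR R z" "variation_bounds R h'"
    using h by (auto simp: K_R_iff)
  have tv: "total_variation \<alpha> \<gamma> (?m u v) \<le> C" if "total_variation \<alpha> \<gamma> u \<le> C" "total_variation \<alpha> \<gamma> v \<le> C" 
    for \<alpha> \<gamma> u v C
  proof (rule total_variation_leI)
    fix m and x :: "nat \<Rightarrow> real" assume x: "x 0 = \<alpha>" "x m = \<gamma>" "\<And>i. i < m \<Longrightarrow> x i < x (Suc i)"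
    let ?d = "\<lambda>u i. \<bar>u (x (Suc i)) - u (x i)\<bar>"
    have "?d (?m u v) i \<le> 1 / 2 * ?d u i + 1 / 2 * ?d v i" for i
      by (simp add: abs_if field_simps)
    then have "(\<Sum>i<m. ennreal (?d (?m u v) i)) \<le> (\<Sum>i<m. ennreal (1 / 2 * ?d u i + 1 / 2 * ?d v i))"
      by (intro sum_mono ennreal_leI)
    also have "\<dots> = ennreal (1 / 2) * (\<Sum>i<m. ennreal (?d u i)) + ennreal (1 / 2) * (\<Sum>i<m. ennreal (?d v i))"
    proof -
      have "ennreal (1 / 2 * p + 1 / 2 * q) = ennreal (1 / 2) * ennreal p + ennreal (1 / 2) * ennreal q"
        if "0 \<le> p" "0 \<le> q" for p q
      proof -
        have "ennreal (1 / 2 * p) = ennreal (1 / 2) * ennreal p" "ennreal (1 / 2 * q) = ennreal (1 / 2) * ennreal q"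
          using that by (intro ennreal_mult; simp)+
        then show ?thesis using ennreal_plus[of "1 / 2 * p" "1 / 2 * q"] that by simp
      qed
      then show ?thesis by (simp only: abs_ge_zero sum.distrib sum_distrib_left)
    qed
    also have "\<dots> \<le> ennreal (1 / 2) * C + ennreal (1 / 2) * C"
      using total_variation_ge[OF x, of u] total_variation_ge[OF x, of v] that
      by (intro add_mono mult_left_mono) (auto intro: order_trans)
    also have "\<dots> = C"
      unfolding distrib_right[symmetric] by (subst ennreal_plus[symmetric]) auto
    finally show "(\<Sum>i<m. ennreal (?d (?m u v) i)) \<le> C" .
  qed
  have "?m f h \<in> locally_bv"
    unfolding locally_bv_def
  proof (clarify)
    fix \<alpha> \<gamma> :: real assume "0 < \<alpha>" "\<alpha> < \<gamma>"
    then have "max (total_variation \<alpha> \<gamma> f) (total_variation \<alpha> \<gamma> h) < \<infinity>"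
      using f h by (auto simp: K_R_iff K_all_def locally_bv_def)
    then show "total_variation \<alpha> \<gamma> (?m f h) < \<infinity>" by (rule le_less_trans[OF tv, rotated 2]) auto
  qed
  \<comment> \<open>The weights sum to 1, so averaging \<open>undefined\<close> with itself gives
    \<open>undefined\<close> again.\<close>
  moreover have "?m f h \<in> extensional {0<..}"
    using f h by (auto simp: K_R_iff K_all_def L_mu_def extensional_def)
  moreover have "continuous (at_right z) (?m f h)" "0 \<le> ?m f h z" if "0 < z" for z
    using f h that by (auto simp: K_R_iff K_all_def intro!: continuous_intros)
  moreover have "integrable mu (?m f h)" using K_integrable f h by simp
  ultimately have "?m f h \<in> K_all" by (simp add: K_all_def L_mu_def)
  moreover have "AE z in mu. ?m f h z = ?m f' h' z" using f'(1) h'(1) by eventually_elim simp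
  moreover have "?m f' h' z \<le> kR R z" if "0 < z" for z using f'(2)[OF that] h'(2)[OF that] by simp
  moreover have "variation_bounds R (?m f' h')"
    using f'(3) h'(3) unfolding variation_bounds_def by (intro allI impI max.boundedI tv) auto
  ultimately show ?thesis unfolding K_R_iff by (intro conjI exI[of _ "?m f' h'"] allI impI)
qed

lemma T_diff_le:
  assumes "f \<in> K" "h \<in> K" "0 \<le> l"
  shows "\<bar>T f l - T h l\<bar> \<le> max 2 l * mu_abs (\<lambda>z. f z - h z)"
proof -
  note int = K_integrable[OF assms(1)] K_integrable[OF assms(2)]
  have "integrable mu (\<lambda>z. f z - h z)" using int by simp
  from T_op_bound[OF this bc assms(3)] show ?thesis unfolding T_op_diff[OF int bc assms(3)] .
qed

lemma T_measurable [measurable]: "f \<in> K \<Longrightarrow> T f \<in> borel_measurable borel"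
  using K_integrable by (intro T_op_measurable) auto

lemma crit_eq:
  assumes "f \<in> K"
  shows "crit x f = (LINT l|\<nu>. (g x l - T f l)\<^sup>2)"
proof -
  note weight_measurable[OF w, measurable] T_measurable[OF assms, measurable]
  have "(LINT l|\<nu>. (g x l - T f l)\<^sup>2) = (LINT l|lborel. (indicator {0..} l * w l) *\<^sub>R (g x l - T f l)\<^sup>2)"
    unfolding weight_measure_def
  proof (rule integral_density)
    show "AE l in lborel. 0 \<le> indicator {0..} l * w l"
      using w by (auto simp: weight_function_def indicator_def)
  qed measurable
  then show ?thesis
    by (simp add: criterion_def set_lebesgue_integral_def mult_ac)
qed

text \<open>For given data one constant serves all of \<open>K\<close>, because
  \<open>mu_abs f\<close> is at most \<open>mu_abs (kR R)\<close> and the weight lives on some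
  [0, L]. It provides the dominating function for the criterion.\<close>

lemma residual_bound:
  "\<exists>C. \<forall>f\<in>K. AE l in \<nu>. \<bar>g x l - T f l\<bar> \<le> C"
proof -
  obtain L where L: "AE l in \<nu>. 0 \<le> l \<and> l \<le> L" using weight_measure_bounded[OF w] by blast
  obtain G where G: "\<forall>l. 0 \<le> l \<and> l \<le> L \<longrightarrow> \<bar>g x l\<bar> \<le> G" using g_n_bounded[OF n bc] by blast
  have "AE l in \<nu>. \<bar>g x l - T f l\<bar> \<le> G + max 2 L * mu_abs (kR R)" if f: "f \<in> K" for f
    using L
  proof eventually_elim
    case (elim l)
    have "0 \<le> mu_abs f" by (simp add: mu_abs_def)
    then have "max 2 l * mu_abs f \<le> max 2 L * mu_abs (kR R)"
      using elim mu_abs_K[OF f] by (intro mult_mono) auto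
    moreover have "\<bar>T f l\<bar> \<le> max 2 l * mu_abs f"
      using T_op_bound[OF K_integrable[OF f] bc] elim by blast
    moreover have "\<bar>g x l\<bar> \<le> G" using G elim by blast
    ultimately show ?case by linarith
  qed
  then show ?thesis by blast
qed

lemma bounded_integrable:
  fixes u :: "real \<Rightarrow> real"
  assumes "u \<in> borel_measurable borel" "AE l in \<nu>. \<bar>u l\<bar> \<le> C"
  shows "integrable \<nu> (\<lambda>l. (u l)\<^sup>2)"
proof -
  interpret finite_measure \<nu> by (rule finite_weight_measure[OF w])
  have [measurable]: "u \<in> borel_measurable \<nu>" using assms(1) by (simp cong: measurable_cong_sets)
  have "AE l in \<nu>. norm ((u l)\<^sup>2) \<le> C\<^sup>2"
    using assms(2) by eventually_elim (metis abs_ge_zero norm_power power2_abs power_mono real_norm_def)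
  then show ?thesis by (rule integrable_const_bound) measurable
qed

lemma crit_tendsto:
  assumes \<sigma>: "\<And>k. \<sigma> k \<in> K" and f: "f \<in> K" and lim: "(\<lambda>k. mu_abs (\<lambda>z. \<sigma> k z - f z)) \<longlonglongrightarrow> 0"
  shows "(\<lambda>k. crit x (\<sigma> k)) \<longlonglongrightarrow> crit x f"
proof -
  interpret finite_measure \<nu> by (rule finite_weight_measure[OF w])
  obtain C where C: "\<forall>f\<in>K. AE l in \<nu>. \<bar>g x l - T f l\<bar> \<le> C" using residual_bound by blast
  show ?thesis
    unfolding crit_eq[OF \<sigma>] crit_eq[OF f]
  proof (rule integral_dominated_convergence)
    note [measurable] = T_measurable[OF f] T_measurable[OF \<sigma>]
    show "(\<lambda>l. (g x l - T f l)\<^sup>2) \<in> borel_measurable \<nu>" "(\<lambda>l. (g x l - T (\<sigma> k) l)\<^sup>2) \<in> borel_measurable \<nu>" for k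
      by measurable
    show "integrable \<nu> (\<lambda>_. C\<^sup>2)" by simp
    show "AE l in \<nu>. norm ((g x l - T (\<sigma> k) l)\<^sup>2) \<le> C\<^sup>2" for k
      using bspec[OF C \<sigma>[of k]]
      by eventually_elim (metis abs_ge_zero norm_power power2_abs power_mono real_norm_def)
    obtain L where L: "AE l in \<nu>. 0 \<le> l \<and> l \<le> L" using weight_measure_bounded[OF w] by blast
    then show "AE l in \<nu>. (\<lambda>k. (g x l - T (\<sigma> k) l)\<^sup>2) \<longlonglongrightarrow> (g x l - T f l)\<^sup>2"
    proof eventually_elim
      case (elim l)
      have "(\<lambda>k. T (\<sigma> k) l - T f l) \<longlonglongrightarrow> 0"
      proof (rule Lim_null_comparison)
        show "eventually (\<lambda>k. norm (T (\<sigma> k) l - T f l) \<le> max 2 l * mu_abs (\<lambda>z. \<sigma> k z - f z)) sequentially"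
          using T_diff_le[OF \<sigma> f] elim by (intro always_eventually) auto
        show "(\<lambda>k. max 2 l * mu_abs (\<lambda>z. \<sigma> k z - f z)) \<longlonglongrightarrow> 0"
          using tendsto_mult_right_zero[OF lim] .
      qed
      then have "(\<lambda>k. T (\<sigma> k) l) \<longlonglongrightarrow> T f l" by (rule LIM_zero_cancel)
      then show ?case by (intro tendsto_intros)
    qed
  qed
qed

lemma crit_continuous: "continuous_map K.mtopology euclideanreal (crit x)"
proof (rule K.continuous_map_real_sequentially)
  fix \<sigma> f assume "range \<sigma> \<subseteq> K" "limitin K.mtopology \<sigma> f sequentially"
  then show "(\<lambda>k. crit x (\<sigma> k)) \<longlonglongrightarrow> crit x f"
    unfolding K.limitin_metric_dist_null by (intro crit_tendsto) auto
qed

section \<open>Uniqueness of the minimizer\<close>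

lemma T_inj:
  assumes f: "f \<in> K" and h: "h \<in> K" and ae: "AE l in \<nu>. T f l = T h l"
  shows "f = h"
proof -
  note int = K_integrable[OF f] K_integrable[OF h]
  define d where "d z = f z - h z" for z
  have d: "integrable mu d" unfolding d_def[abs_def] using int by simp
  have T_d: "T d l = T f l - T h l" if "0 \<le> l" for l
    unfolding d_def using T_op_diff[OF int bc that] .
  \<comment> \<open>Equality is known only almost everywhere on {w \<noteq> 0}. A nonzero value at l
    would persist on a ball by continuity, and l in the support gives that ball positive measure on
    {w \<noteq> 0}. Since l > \<open>a\<^sub>0\<close> >= 0, the point l is positive, as continuity
    requires.\<close>
  have "T d l = 0" if l: "a\<^sub>0 < l" "l < b\<^sub>0" for l
  proof (rule ccontr)
    assume "T d l \<noteq> 0"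
    moreover have "isCont (T d) l" using T_op_isCont[OF d bc] l ab by simp
    ultimately have "eventually (\<lambda>y. T d y \<noteq> 0) (nhds l)"
      using tendsto_imp_eventually_ne by (auto simp: continuous_at eventually_nhds_conv_at)
    then obtain e where e: "0 < e" "\<And>y. dist y l < e \<Longrightarrow> T d y \<noteq> 0"
      unfolding eventually_nhds_metric by blast
    have "AE y in lborel. y \<notin> {y \<in> ball l e. 0 \<le> y \<and> w y \<noteq> 0}"
      using ae unfolding AE_weight_measure_iff[OF w]
    proof eventually_elim
      case (elim y)
      show ?case
      proof
        assume y: "y \<in> {y \<in> ball l e. 0 \<le> y \<and> w y \<noteq> 0}"
        then have "T d y = 0" using elim T_d by simp
        then show False using e(2)[of y] y by (simp add: dist_commute)
      qed
    qed
    then have "emeasure lborel {y \<in> ball l e. 0 \<le> y \<and> w y \<noteq> 0} = 0"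
      using sets_weight_nonzero[OF w, of "ball l e"]
      by (subst (asm) AE_iff_null_sets[symmetric]) auto
    moreover have "l \<in> weight_support w" using ab l by auto
    then have "0 < emeasure lborel {y \<in> ball l e. 0 \<le> y \<and> w y \<noteq> 0}"
      using e(1) unfolding weight_support_def by blast
    ultimately show False by simp
  qed
  then have "levy_exponent d u = 0" if "0 < Re u" for u
    using levy_exponent_zero[OF d bc ab(1,2) _ that] by blast
  then have "AE z in mu. f z = h z"
    using f h unfolding d_def
    by (intro levy_exponent_unique int) (auto simp: K_R_iff K_all_def)
  then show ?thesis by (rule K_eqI[OF f h])
qed

text \<open>Parallelogram identity at the midpoint of two minimizers.\<close>

lemma crit_min_unique:
  assumes f: "f \<in> K" and h: "h \<in> K"
    and min: "\<And>k. k \<in> K \<Longrightarrow> crit x f \<le> crit x k" "crit x h \<le> crit x f"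
  shows "f = h"
proof (rule T_inj[OF f h])
  let ?m = "\<lambda>z. 1 / 2 * f z + 1 / 2 * h z"
  note m = midpoint_K[OF f h]
  note [measurable] = T_measurable[OF f] T_measurable[OF h] T_measurable[OF m]
  obtain C where C: "\<forall>f\<in>K. AE l in \<nu>. \<bar>g x l - T f l\<bar> \<le> C" using residual_bound by blast
  obtain L where L: "AE l in \<nu>. 0 \<le> l \<and> l \<le> L" using weight_measure_bounded[OF w] by blast
  have i: "integrable \<nu> (\<lambda>l. (g x l - T f l)\<^sup>2)" "integrable \<nu> (\<lambda>l. (g x l - T h l)\<^sup>2)"
    using C f h by (auto intro!: bounded_integrable)
  have "AE l in \<nu>. \<bar>T f l - T h l\<bar> \<le> 2 * C"
    using bspec[OF C f] bspec[OF C h] by eventually_elim linarith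
  then have i': "integrable \<nu> (\<lambda>l. (T f l - T h l)\<^sup>2)" by (intro bounded_integrable) auto
  \<comment> \<open>For the residuals A and B, ((A + B) / 2)^2 = A^2 / 2 + B^2 / 2 - (A - B)^2 / 4.
    Linearity of \<open>T\<close> is available for l >= 0, which holds almost everywhere.\<close>
  have "crit x ?m = (LINT l|\<nu>. 1 / 2 * (g x l - T f l)\<^sup>2 + 1 / 2 * (g x l - T h l)\<^sup>2 - 1 / 4 * (T f l - T h l)\<^sup>2)"
    unfolding crit_eq[OF m]
  proof (rule integral_cong_AE)
    show "AE l in \<nu>. (g x l - T ?m l)\<^sup>2 =
        1 / 2 * (g x l - T f l)\<^sup>2 + 1 / 2 * (g x l - T h l)\<^sup>2 - 1 / 4 * (T f l - T h l)\<^sup>2"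
      using L
    proof eventually_elim
      case (elim l)
      have "T ?m l = 1 / 2 * T f l + 1 / 2 * T h l"
        using T_op_linear[OF K_integrable[OF f] K_integrable[OF h] bc] elim by blast
      then show ?case by (simp only:) (simp add: power2_eq_square field_simps)
    qed
  qed measurable
  also have "\<dots> = 1 / 2 * crit x f + 1 / 2 * crit x h - 1 / 4 * (LINT l|\<nu>. (T f l - T h l)\<^sup>2)"
    unfolding crit_eq[OF f] crit_eq[OF h] using i i' by simp
  \<comment> \<open>The midpoint cannot beat \<open>f\<close>, so a quarter of the integral is at
    most (crit x h - crit x f) / 2 <= 0.\<close>
  finally have "(LINT l|\<nu>. (T f l - T h l)\<^sup>2) \<le> 0"
    using min(1)[OF m] min(2) by simp
  then have "(LINT l|\<nu>. (T f l - T h l)\<^sup>2) = 0" by (intro antisym) auto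
  then have "AE l in \<nu>. (T f l - T h l)\<^sup>2 = 0"
    using i' by (subst (asm) integral_nonneg_eq_0_iff_AE) auto
  then show "AE l in \<nu>. T f l = T h l" by eventually_elim simp
qed

lemma ex1_arg_min: "\<exists>!f. is_arg_min (crit x) (\<lambda>f. f \<in> K) f"
proof -
  obtain f where f: "f \<in> K" "\<And>h. h \<in> K \<Longrightarrow> crit x f \<le> crit x h"
    using K.compactin_attains_min[OF crit_continuous, of K x] compact_K K_nonempty
    unfolding compact_space_def K.topspace_mtopology by metis
  show ?thesis
  proof (rule ex1I)
    show "is_arg_min (crit x) (\<lambda>f. f \<in> K) f"
      using f by (auto simp: is_arg_min_def not_less)
    show "h = f" if "is_arg_min (crit x) (\<lambda>f. f \<in> K) h" for h
      using crit_min_unique[OF f(1) _ f(2)] that f by (auto simp: is_arg_min_def not_less)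
  qed
qed

text \<open>\<open>arg_min_on\<close> is a choice operator; existence of a minimizer is what gives
  the chosen value this property.\<close>

lemma estimator_arg_min: "is_arg_min (crit x) (\<lambda>f. f \<in> K) (estimator b \<beta> c w kR R n x)"
  unfolding estimator_def arg_min_on_def arg_min_def
  using ex1_implies_ex[OF ex1_arg_min] by (rule someI_ex)

section \<open>Measurability in the data\<close>

lemma crit_measurable:
  assumes "f \<in> K"
  shows "(\<lambda>x. crit x f) \<in> borel_measurable (PiM {..n} (\<lambda>_. borel))"
proof -
  note [measurable] = T_measurable[OF assms]
  interpret finite_measure \<nu> by (rule finite_weight_measure[OF w])
  have [measurable]: "(\<lambda>(x, l). g x l) \<in> borel_measurable (PiM {..n} (\<lambda>_. borel) \<Otimes>\<^sub>M \<nu>)"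
    using g_n_measurable by (simp cong: measurable_cong_sets sets_pair_measure_cong)
  show ?thesis unfolding crit_eq[OF assms] by measurable
qed

lemma estimator_measurable:
  "estimator b \<beta> c w kR R n \<in> PiM {..n} (\<lambda>_. borel) \<rightarrow>\<^sub>M borel_L_mu"
  unfolding borel_L_mu_def
proof (rule measurable_measure_of)
  let ?e = "estimator b \<beta> c w kR R n" and ?N = "PiM {..n} (\<lambda>_. borel :: real measure)"
  have e: "?e x \<in> K" "\<And>h. h \<in> K \<Longrightarrow> crit x (?e x) \<le> crit x h" for x
    using estimator_arg_min[of x] by (auto simp: is_arg_min_def not_less)
  show "?e \<in> space ?N \<rightarrow> L_mu" using e(1) K_L_mu by auto
  fix U assume U: "U \<in> {U. U \<subseteq> L_mu \<and> (\<forall>f\<in>U. \<exists>e>0. \<forall>g\<in>L_mu. mu_abs (\<lambda>z. g z - f z) < e \<longrightarrow> g \<in> U)}"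
  \<comment> \<open>A generator of \<open>borel_L_mu\<close> is open for the seminorm on all of
    \<open>L_mu\<close>, so its trace on \<open>K\<close> is open in the metric topology.
    Intersecting with \<open>K\<close> loses nothing because the estimator takes its values
    there.\<close>
  have open_U: "openin K.mtopology (U \<inter> K)"
    unfolding K.openin_mtopology
  proof (intro conjI allI impI)
    fix f assume "f \<in> U \<inter> K"
    then obtain r where r: "0 < r" "\<And>h. h \<in> L_mu \<Longrightarrow> mu_abs (\<lambda>z. h z - f z) < r \<Longrightarrow> h \<in> U"
      using U by blast
    have "K.mball f r \<subseteq> U \<inter> K"
      using r(2) K_L_mu by (auto simp: K.commute[of f])
    then show "\<exists>r>0. K.mball f r \<subseteq> U \<inter> K" using r(1) by blast
  qed auto
  have "{x \<in> space ?N. ?e x \<in> U \<inter> K} \<in> sets ?N"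
  proof (rule K.measurable_arg_min[where crit = crit and U = "U \<inter> K",
        OF compact_K crit_continuous crit_measurable e(1) _ open_U])
    fix x f assume f: "f \<in> K" "f \<noteq> ?e x"
    show "crit x (?e x) < crit x f"
      using crit_min_unique[of "?e x" f x, OF e(1) f(1) e(2)] f(2) by fastforce
  qed
  also have "{x \<in> space ?N. ?e x \<in> U \<inter> K} = ?e -` U \<inter> space ?N" using e(1) by auto
  finally show "?e -` U \<inter> space ?N \<in> sets ?N" .
qed auto

end

text \<open>The sigma-algebra generated by the sample expresses that the estimator is a function of
  the observations; \<open>sample\<close> is restricted to the indices up to n so that its values
  are points of the product space.\<close>

lemma sample_measurable:
  "sample X n \<in> vimage_algebra S (sample X n) (PiM {..n} (\<lambda>_. borel)) \<rightarrow>\<^sub>M PiM {..n} (\<lambda>_. borel)"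
  by (rule measurable_vimage_algebra1) (auto simp: sample_def space_PiM)

theorem theorem1p1:
  fixes M :: "'a measure" and F :: "real \<Rightarrow> 'a measure"
    and B :: "real \<Rightarrow> 'a \<Rightarrow> real" and N :: "'a \<Rightarrow> (real \<times> real) measure"
    and X :: "real \<Rightarrow> 'a \<Rightarrow> real" and P :: "real \<Rightarrow> real \<Rightarrow> real measure"
    and \<eta> :: "real measure" and b \<beta> c :: real and k :: "real \<Rightarrow> real"
    and kR :: "nat \<Rightarrow> real \<Rightarrow> real" and w :: "real \<Rightarrow> real"
    and a\<^sub>0 b\<^sub>0 :: real and R n :: nat
  assumes "stationary_model M F B N X P \<eta> b \<beta> c k"
    and "envelope_sequence kR"
    and "weight_function w"
    and "0 \<le> a\<^sub>0" and "a\<^sub>0 < b\<^sub>0" and "{a\<^sub>0..b\<^sub>0} \<subseteq> weight_support w"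
    and "1 \<le> R" and "1 \<le> n"
  shows "(\<forall>\<omega>\<in>space M. \<exists>!f. is_arg_min (criterion b \<beta> c w n (sample X n \<omega>)) (\<lambda>f. f \<in> K_R kR R) f) \<and>
         (\<lambda>\<omega>. estimator b \<beta> c w kR R n (sample X n \<omega>))
           \<in> vimage_algebra (space M) (sample X n) (PiM {..n} (\<lambda>_. borel)) \<rightarrow>\<^sub>M borel_L_mu"
proof -
  interpret stationary_model M F B N X P \<eta> b \<beta> c k by (rule assms(1))
  interpret mc: minimum_contrast b \<beta> c w kR a\<^sub>0 b\<^sub>0 R n
    using assms pos by unfold_locales auto
  show ?thesis
    using mc.ex1_arg_min measurable_compose[OF sample_measurable mc.estimator_measurable] by blast
qed

end
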